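(* There exist a free $(\mathbb Z\times\mathbb Z)$-module $M$ of finite rank and a fixed finitely generated subsemimodule $N$ of $M$ such that membership in $N$ is undecidable: there is no algorithm that, given an element of $M$, decides whether it belongs to $N$.
   Context: A free $(\mathbb Z\times\mathbb Z)$-module of rank $k$ is a free module over the group ring $\mathbb Z[\mathbb Z\times\mathbb Z]$ on $k$ generators; its elements can be identified with finitely supported functions $(\mathbb Z\times\mathbb Z)\times X\to\mathbb Z$ ($|X|=k$) with pointwise addition and action $(g_0f)(g,x)=f(g_0^{-1}g,x)$, and are given to the algorithm in this (finite) form. A subsemimodule is a submonoid closed under the action of $\mathbb Z\times\mathbb Z$; it is finitely generated if it is the set of all finite sums $\sum_i g_i b_i$ with $g_i\in\mathbb Z\times\mathbb Z$ and $b_i$ from a fixed finite set. *)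

theory Defs
  imports Main "HOL-Library.Nat_Bijection"
begin

datatype recf = Zero | Succ | Proj nat | Comp recf "recf list" | Prim recf recf | Mn recf

inductive eval :: "recf \<Rightarrow> nat list \<Rightarrow> nat \<Rightarrow> bool" where
  eval_Zero: "eval Zero xs 0"
| eval_Succ: "eval Succ (x # xs) (Suc x)"
| eval_Proj: "i < length xs \<Longrightarrow> eval (Proj i) xs (xs ! i)"
| eval_Comp: "length ys = length gs \<Longrightarrow> (\<forall>i < length gs. eval (gs ! i) xs (ys ! i))
               \<Longrightarrow> eval f ys z \<Longrightarrow> eval (Comp f gs) xs z"
| eval_Prim0: "eval f xs y \<Longrightarrow> eval (Prim f g) (0 # xs) y"
| eval_PrimS: "eval (Prim f g) (n # xs) y \<Longrightarrow> eval g (n # y # xs) z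
               \<Longrightarrow> eval (Prim f g) (Suc n # xs) z"
| eval_Mn: "eval f (n # xs) 0 \<Longrightarrow> (\<forall>m < n. \<exists>y. eval f (m # xs) y \<and> y \<noteq> 0)
               \<Longrightarrow> eval (Mn f) xs n"

definition decidable_nat_set :: "nat set \<Rightarrow> bool" where
  "decidable_nat_set A \<longleftrightarrow> (\<exists>f. \<forall>n. eval f [n] (if n \<in> A then 1 else 0))"

text \<open>Elements of the free module of rank k: finitely supported functions
  (Z x Z) x X \<Rightarrow> Z with X = {0..<k}.\<close>
type_synonym elem = "(int \<times> int) \<times> nat \<Rightarrow> int"

definition free_module :: "nat \<Rightarrow> elem set" where
  "free_module k = {f. finite {p. f p \<noteq> 0} \<and> (\<forall>g x. x \<ge> k \<longrightarrow> f (g, x) = 0)}"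

text \<open>Action: (g0 f)(g,x) = f(g0^{-1} g, x) = f(g - g0, x).\<close>
definition act :: "int \<times> int \<Rightarrow> elem \<Rightarrow> elem" where
  "act g0 f = (\<lambda>(g, x). f ((fst g - fst g0, snd g - snd g0), x))"

inductive_set semimod_gen :: "elem set \<Rightarrow> elem set" for B where
  sg_zero: "(\<lambda>_. 0) \<in> semimod_gen B"
| sg_gen: "b \<in> B \<Longrightarrow> act g b \<in> semimod_gen B"
| sg_add: "u \<in> semimod_gen B \<Longrightarrow> v \<in> semimod_gen B \<Longrightarrow> (\<lambda>p. u p + v p) \<in> semimod_gen B"

type_synonym entry = "(int \<times> int) \<times> nat \<times> int"

definition denote :: "entry list \<Rightarrow> elem" where
  "denote l = (\<lambda>(g, x). sum_list (map (\<lambda>(h, y, c). if h = g \<and> y = x then c else 0) l))"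

definition valid_input :: "nat \<Rightarrow> entry list \<Rightarrow> bool" where
  "valid_input k l \<longleftrightarrow> (\<forall>(h, y, c) \<in> set l. y < k)"

definition encode_entry :: "entry \<Rightarrow> nat" where
  "encode_entry e = (case e of ((a, b), x, c) \<Rightarrow>
     prod_encode (prod_encode (int_encode a, int_encode b), prod_encode (x, int_encode c)))"

definition encode_input :: "entry list \<Rightarrow> nat" where
  "encode_input l = list_encode (map encode_entry l)"

definition membership_problem :: "nat \<Rightarrow> elem set \<Rightarrow> nat set" where
  "membership_problem k N = {encode_input l | l. valid_input k l \<and> denote l \<in> N}"

end

theory Submission
  imports Defs "HOL-Library.Multiset"
begin

text \<open>
  The first coordinate of the group is read as time. A generator that consists of tokens \<open>l\<close> at time
  \<open>0\<close> minus tokens \<open>r\<close> at time \<open>1\<close> is a rule \<open>l \<rightarrow> r\<close>, and a configuration placed at a single time is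
  a sum of translated generators iff it can be rewritten to nothing in steps that consume all tokens
  simultaneously: at the earliest time involved, nothing but the configuration itself can account for the
  consumed tokens.
  If every rule except the idle ones consumes a head, a configuration with one head behaves like a
  sequential machine moving on the second coordinate, whose registers are the numbers of the tokens of
  each kind under the head.

  To execute an instruction the head carries the tokens one by one from position \<open>p\<close> to \<open>p + 1\<close> and
  moves to \<open>p + 1\<close>. Tokens left behind never disappear, so the transfer is complete in every successful
  run, and a kind of tokens that cannot be carried is thereby tested for zero. The resulting relations
  between register contents are closed under converse. Hence a pattern can be matched by running
  backwards a program that builds it from guessed values, and counters simulate rewriting of coded terms.
  In particular they simulate a goal-directed search for derivations of \<^const>\<open>eval\<close>, and a decision
  procedure for the membership problem would be refuted by its own code.
\<close>

section \<open>Synchronous token systems\<close>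

type_synonym tok = "int \<times> nat"
type_synonym rule = "tok multiset \<times> tok multiset"

definition shift :: "int \<Rightarrow> tok multiset \<Rightarrow> tok multiset" where
  "shift p S = image_mset (\<lambda>(x, y). (x + p, y)) S"

definition layer :: "int \<Rightarrow> tok multiset \<Rightarrow> elem" where
  "layer t S = (\<lambda>((t', x), y). if t' = t then int (count S (x, y)) else 0)"

definition gen :: "rule \<Rightarrow> elem" where
  "gen c = (\<lambda>q. layer 0 (fst c) q - layer 1 (snd c) q)"

definition consumed :: "(rule \<times> int) list \<Rightarrow> tok multiset" where
  "consumed w = (\<Sum>(c, p)\<leftarrow>w. shift p (fst c))"

definition produced :: "(rule \<times> int) list \<Rightarrow> tok multiset" where
  "produced w = (\<Sum>(c, p)\<leftarrow>w. shift p (snd c))"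

text \<open>The word consumes the whole configuration at once, so a token survives a step only
  through a rule that produces it again.\<close>

inductive vanish :: "rule set \<Rightarrow> tok multiset \<Rightarrow> bool" for R where
  vanish_empty: "vanish R {#}"
| vanish_step: "fst ` set w \<subseteq> R \<Longrightarrow> vanish R (produced w) \<Longrightarrow> vanish R (consumed w)"

lemma shift_simps [simp]:
  "shift p {#} = {#}"
  "shift p (add_mset (x, y) S) = add_mset (x + p, y) (shift p S)"
  "shift p (S + T) = shift p S + shift p T"
  by (simp_all add: shift_def)

lemma shift_eq_empty [simp]: "shift p S = {#} \<longleftrightarrow> S = {#}"
  by (simp add: shift_def)

lemma count_shift: "count (shift p S) (x, y) = count S (x - p, y)"
proof (induction S)
  case (add q S)
  then show ?case by (cases q) (auto simp: eq_diff_eq)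
qed simp

lemma layer_simps [simp]:
  "layer t {#} q = 0"
  "layer t (S + T) q = layer t S q + layer t T q"
  by (auto simp: layer_def split: prod.splits)

lemma act_gen: "act (t, p) (gen c) q = layer t (shift p (fst c)) q - layer (t + 1) (shift p (snd c)) q"
  by (auto simp: act_def gen_def layer_def count_shift split: prod.splits)

lemma consumed_simps [simp]:
  "consumed [] = {#}"
  "consumed ((c, p) # w) = shift p (fst c) + consumed w"
  "consumed (v @ w) = consumed v + consumed w"
  by (simp_all add: consumed_def)

lemma produced_simps [simp]:
  "produced [] = {#}"
  "produced ((c, p) # w) = shift p (snd c) + produced w"
  "produced (v @ w) = produced v + produced w"
  by (simp_all add: produced_def)

lemma layer_step_in_semimod:
  assumes "fst ` set w \<subseteq> R" "f \<in> semimod_gen (gen ` R)"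
  shows "(\<lambda>q. f q + layer t (consumed w) q - layer (t + 1) (produced w) q) \<in> semimod_gen (gen ` R)"
  using assms(1)
proof (induction w)
  case Nil
  then show ?case using assms(2) by simp
next
  case (Cons u w)
  obtain c p where u: "u = (c, p)" by (cases u)
  have "act (t, p) (gen c) \<in> semimod_gen (gen ` R)"
    using Cons.prems u by (auto intro: sg_gen)
  from sg_add [OF this Cons.IH] Cons.prems show ?case
    by (simp add: u act_gen algebra_simps)
qed

text \<open>Each step is placed at its own time, and the layer of tokens it produces cancels against
  the layer consumed one time unit later. This is why \<open>t\<close> is arbitrary in the
  induction.\<close>

lemma vanish_imp_semimod: "vanish R S \<Longrightarrow> layer t S \<in> semimod_gen (gen ` R)"
proof (induction arbitrary: t rule: vanish.induct)
  case vanish_empty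
  have "layer t {#} = (\<lambda>_. 0)" by (auto simp: fun_eq_iff)
  then show ?case by (metis sg_zero)
next
  case (vanish_step w)
  from layer_step_in_semimod [OF vanish_step(1) vanish_step(3) [of "t + 1"], of t]
  show ?case by simp
qed

section \<open>Sums of translated generators, decomposed by time\<close>

type_synonym use = "rule \<times> int \<times> int"

definition use_sum :: "use list \<Rightarrow> elem" where
  "use_sum us q = (\<Sum>(c, g)\<leftarrow>us. act g (gen c) q)"

lemma use_sum_simps [simp]:
  "use_sum [] q = 0"
  "use_sum ((c, g) # us) q = act g (gen c) q + use_sum us q"
  "use_sum (us @ vs) q = use_sum us q + use_sum vs q"
  by (simp_all add: use_sum_def)

lemma semimod_gen_use_sum:
  "f \<in> semimod_gen (gen ` R) \<Longrightarrow> \<exists>us. fst ` set us \<subseteq> R \<and> f = use_sum us"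
proof (induction rule: semimod_gen.induct)
  case sg_zero
  show ?case by (rule exI [of _ "[]"]) (auto simp: fun_eq_iff)
next
  case (sg_gen b g)
  then obtain c where "c \<in> R" "b = gen c" by auto
  then show ?case by (intro exI [of _ "[(c, g)]"]) auto
next
  case (sg_add u v)
  then obtain us vs where "fst ` set us \<subseteq> R" "u = use_sum us" "fst ` set vs \<subseteq> R" "v = use_sum vs"
    by auto
  then show ?case by (intro exI [of _ "us @ vs"]) (auto simp: fun_eq_iff)
qed

definition fired :: "int \<Rightarrow> use list \<Rightarrow> (rule \<times> int) list" where
  "fired t us = [(c, p). (c, (t', p)) \<leftarrow> us, t' = t]"

definition unfired :: "int \<Rightarrow> use list \<Rightarrow> use list" where
  "unfired t us = filter (\<lambda>u. fst (snd u) \<noteq> t) us"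

lemma use_sum_split:
  "use_sum us q = layer t (consumed (fired t us)) q - layer (t + 1) (produced (fired t us)) q
     + use_sum (unfired t us) q"
  by (induction us) (auto simp: fired_def unfired_def act_gen)

text \<open>A translate at time \<open>t'\<close> is supported on the times \<open>t'\<close> and
  \<open>t' + 1\<close> only.\<close>

lemma use_sum_later: "(\<And>u. u \<in> set us \<Longrightarrow> fst (snd u) > t) \<Longrightarrow> use_sum us ((t, x), y) = 0"
proof (induction us)
  case (Cons u us)
  have "t < fst (snd u)" using Cons.prems by simp
  moreover have "use_sum us ((t, x), y) = 0" using Cons by simp
  ultimately show ?case by (cases u) (auto simp: act_gen layer_def)
qed simp

lemma
  shows length_fired_unfired: "length us = length (fired t us) + length (unfired t us)"
    and set_fired: "fst ` set (fired t us) \<subseteq> fst ` set us"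
    and set_unfired: "set (unfired t us) \<subseteq> set us"
proof -
  show "length us = length (fired t us) + length (unfired t us)"
    by (induction us) (auto simp: fired_def unfired_def)
  show "fst ` set (fired t us) \<subseteq> fst ` set us"
  proof
    fix c assume "c \<in> fst ` set (fired t us)"
    then obtain p where "(c, (t, p)) \<in> set us" by (auto simp: fired_def split: if_splits)
    then show "c \<in> fst ` set us" by (metis fst_conv image_eqI)
  qed
qed (simp add: unfired_def)

text \<open>Comparison at the single time \<open>t\<close> suffices, which matters because the sums
  to be compared are controlled only there.\<close>

lemma layer_inject: "(\<And>x y. layer t S ((t, x), y) = layer t T ((t, x), y)) \<Longrightarrow> S = T"
  by (auto simp: layer_def multiset_eq_iff)

lemma consumed_fired_nonempty:
  assumes "(c, (t, p)) \<in> set us" "fst c \<noteq> {#}"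
  shows "consumed (fired t us) \<noteq> {#}"
proof -
  from assms(1) obtain us1 us2 where us: "us = us1 @ (c, (t, p)) # us2"
    by (meson split_list)
  have "fired t us = fired t us1 @ (c, p) # fired t us2" by (simp add: us fired_def)
  then show ?thesis using assms(2) by simp
qed

text \<open>At the earliest time, nothing compensates for the consumed tokens.\<close>

lemma use_sum_eq_layer_times:
  assumes nonempty: "\<And>c. c \<in> fst ` set us \<Longrightarrow> fst c \<noteq> {#}" and eq: "use_sum us = layer t S"
    and u: "u \<in> set us"
  shows "t \<le> fst (snd u)"
proof -
  define t0 where "t0 = Min ((fst \<circ> snd) ` set us)"
  have "t0 \<in> (fst \<circ> snd) ` set us" unfolding t0_def using u by (intro Min_in) auto
  then obtain c p where cp: "(c, (t0, p)) \<in> set us" by force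
  have ge: "t0 \<le> fst (snd v)" if "v \<in> set us" for v
    unfolding t0_def using that by (intro Min_le) auto
  have "use_sum us ((t0, x), y) = layer t0 (consumed (fired t0 us)) ((t0, x), y)" for x y
  proof -
    have "use_sum (unfired t0 us) ((t0, x), y) = 0"
      by (rule use_sum_later) (use ge in \<open>force simp: unfired_def\<close>)
    then show ?thesis by (subst use_sum_split [of _ _ t0]) (simp add: layer_def)
  qed
  moreover have "c \<in> fst ` set us" using image_eqI [OF _ cp, of c fst] by simp
  then have "consumed (fired t0 us) \<noteq> {#}"
    using consumed_fired_nonempty [OF cp] nonempty by blast
  ultimately have "\<not> t0 < t"
    using layer_inject [of t0 "consumed (fired t0 us)" "{#}"] unfolding eq by (auto simp: layer_def)
  then show ?thesis using ge [OF u] by simp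
qed

text \<open>The uses at time \<open>t\<close> form the first step; the remaining ones are fewer and
  represent the produced tokens at time \<open>t + 1\<close>. If nothing fires at \<open>t\<close>,
  then \<open>S\<close> is empty. Nonempty left-hand sides guarantee that no use lies before
  \<open>t\<close>.\<close>

lemma use_sum_imp_vanish:
  assumes nonempty: "\<And>c. c \<in> R \<Longrightarrow> fst c \<noteq> {#}"
  shows "fst ` set us \<subseteq> R \<Longrightarrow> use_sum us = layer t S \<Longrightarrow> vanish R S"
proof (induction "length us" arbitrary: us t S rule: less_induct)
  case less
  have times: "t \<le> fst (snd u)" if "u \<in> set us" for u
    using use_sum_eq_layer_times [OF _ less.prems(2) that] nonempty less.prems(1) by blast
  have split: "layer t S q = layer t (consumed (fired t us)) q
      - layer (t + 1) (produced (fired t us)) q + use_sum (unfired t us) q" for q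
    using use_sum_split [of us q t] less.prems(2) by simp
  have S: "S = consumed (fired t us)"
  proof (rule layer_inject [of t])
    fix x y
    have "use_sum (unfired t us) ((t, x), y) = 0"
      by (rule use_sum_later) (use times in \<open>force simp: unfired_def\<close>)
    then show "layer t S ((t, x), y) = layer t (consumed (fired t us)) ((t, x), y)"
      using split [of "((t, x), y)"] by (simp add: layer_def)
  qed
  have rest: "use_sum (unfired t us) = layer (t + 1) (produced (fired t us))"
  proof
    fix q
    show "use_sum (unfired t us) q = layer (t + 1) (produced (fired t us)) q"
      using split [of q] S by simp
  qed
  show ?case
  proof (cases "fired t us = []")
    case True
    then show ?thesis using S by (simp add: vanish_empty)
  next
    case False
    then have "length (unfired t us) < length us"
      using length_fired_unfired [of us t] by simp
    moreover have "fst ` set (unfired t us) \<subseteq> R"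
      using image_mono [OF set_unfired [of t us], of fst] less.prems(1) by (rule subset_trans)
    moreover have "fst ` set (fired t us) \<subseteq> R"
      using set_fired [of t us] less.prems(1) by (rule subset_trans)
    ultimately show ?thesis
      using less.hyps rest S by (auto intro!: vanish_step)
  qed
qed

theorem layer_in_semimod_iff:
  assumes "\<And>c. c \<in> R \<Longrightarrow> fst c \<noteq> {#}"
  shows "layer t S \<in> semimod_gen (gen ` R) \<longleftrightarrow> vanish R S"
  using semimod_gen_use_sum use_sum_imp_vanish [OF assms] vanish_imp_semimod by metis

section \<open>A single head among inert tokens\<close>

text \<open>Kinds below \<open>m\<close> are passive tokens, which will be register contents; the
  kinds from \<open>m\<close> on are reserved for heads.\<close>

definition inert :: "nat \<Rightarrow> tok multiset \<Rightarrow> bool" where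
  "inert m M \<longleftrightarrow> (\<forall>(x, y) \<in># M. y < m)"

text \<open>The fields are the head, the tokens it takes, its displacement, the new head and the
  tokens it leaves. Both token multisets are relative to the old position of the head.\<close>

type_synonym head_rule = "nat \<times> tok multiset \<times> int \<times> nat \<times> tok multiset"

text \<open>Idle rules let inert tokens wait, and one more rule deletes the final head
  \<open>F\<close>. As idle rules delete nothing, no inert token may be left when the head
  disappears.\<close>

definition rules :: "nat \<Rightarrow> head_rule set \<Rightarrow> nat \<Rightarrow> rule set" where
  "rules m H F = (\<lambda>i. ({#(0, i)#}, {#(0, i)#})) ` {..<m} \<union> {({#(0, F)#}, {#})}
     \<union> (\<lambda>(h, A, d, h', B). (add_mset (0, h) A, add_mset (d, h') B)) ` H"

inductive accepts :: "head_rule set \<Rightarrow> nat \<Rightarrow> int \<Rightarrow> nat \<Rightarrow> tok multiset \<Rightarrow> bool" for H F where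
  accepts_final: "accepts H F p F {#}"
| accepts_step: "(h, A, d, h', B) \<in> H \<Longrightarrow> accepts H F (p + d) h' (M + shift p B)
    \<Longrightarrow> accepts H F p h (M + shift p A)"

definition proper :: "nat \<Rightarrow> head_rule set \<Rightarrow> nat \<Rightarrow> bool" where
  "proper m H F \<longleftrightarrow> m \<le> F \<and>
     (\<forall>(h, A, d, h', B) \<in> H. m \<le> h \<and> inert m A \<and> m \<le> h' \<and> inert m B)"

lemma inert_simps [simp]:
  "inert m {#}"
  "inert m (add_mset (x, y) M) \<longleftrightarrow> y < m \<and> inert m M"
  "inert m (M + N) \<longleftrightarrow> inert m M \<and> inert m N"
  "inert m (shift p M) \<longleftrightarrow> inert m M"
  by (auto simp: inert_def shift_def split: prod.splits)

lemma idle_word: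
  "inert m M \<Longrightarrow> \<exists>w. fst ` set w \<subseteq> rules m H F \<and> consumed w = M \<and> produced w = M"
proof (induction M)
  case empty
  show ?case by (rule exI [of _ "[]"]) simp
next
  case (add q M)
  obtain x i where q: "q = (x, i)" by (cases q)
  from add q obtain w where w: "fst ` set w \<subseteq> rules m H F" "consumed w = M" "produced w = M"
    by auto
  have "({#(0, i)#}, {#(0, i)#}) \<in> rules m H F"
    using add.prems q by (auto simp: rules_def)
  with w show ?case
    by (intro exI [of _ "(({#(0, i)#}, {#(0, i)#}), x) # w"]) (simp add: q)
qed

text \<open>Every rule other than an idle one consumes a head, so the word consists of idle
  rules.\<close>

lemma inert_consumed_imp_idle:
  assumes "proper m H F" "fst ` set w \<subseteq> rules m H F" "inert m (consumed w)"
  shows "produced w = consumed w"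
  using assms(2,3)
proof (induction w)
  case (Cons u w)
  then show ?case using assms(1) by (cases u) (auto simp: rules_def proper_def)
qed simp

lemma accepts_imp_vanish:
  "accepts H F p h M \<Longrightarrow> proper m H F \<Longrightarrow> inert m M \<Longrightarrow> vanish (rules m H F) (add_mset (p, h) M)"
proof (induction rule: accepts.induct)
  case (accepts_final p)
  have "({#(0, F)#}, {#}) \<in> rules m H F" by (simp add: rules_def)
  then have "vanish (rules m H F) (consumed [(({#(0, F)#}, {#}), p)])"
    by (intro vanish_step) (auto simp: vanish_empty)
  then show ?case by simp
next
  case (accepts_step h A d h' B p M)
  let ?c = "(add_mset (0, h) A, add_mset (d, h') B)"
  have "?c \<in> rules m H F" using accepts_step(1) by (force simp: rules_def)
  moreover obtain w where "fst ` set w \<subseteq> rules m H F" "consumed w = M" "produced w = M"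
    using idle_word [of m M H F] accepts_step(5) by auto
  moreover have "inert m B" using accepts_step by (auto simp: proper_def)
  ultimately have "vanish (rules m H F) (consumed ((?c, p) # w))"
    using accepts_step by (intro vanish_step) (auto simp: ac_simps)
  then show ?case using \<open>consumed w = M\<close> by (simp add: ac_simps)
qed

lemma in_consumedE:
  assumes "q \<in># consumed w"
  obtains w1 c p w2 where "w = w1 @ (c, p) # w2" "q \<in># shift p (fst c)"
proof -
  have "\<exists>w1 c p w2. w = w1 @ (c, p) # w2 \<and> q \<in># shift p (fst c)" using assms
  proof (induction w)
    case (Cons u w)
    show ?case
    proof (cases "q \<in># shift (snd u) (fst (fst u))")
      case True
      then show ?thesis by (metis append_Nil prod.collapse)
    next
      case False
      then have "q \<in># consumed w" using Cons.prems by (cases u) auto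
      then show ?thesis using Cons.IH by (metis append_Cons)
    qed
  qed simp
  then show ?thesis using that by blast
qed

text \<open>One use in the word consumes the head; the other uses consume inert tokens only and are
  therefore idle. The second conjunct covers the time after the head is gone: an inert configuration
  reproduces itself, hence can vanish only if it is empty.\<close>

lemma vanish_imp_accepts:
  assumes proper: "proper m H F"
  shows "vanish (rules m H F) S \<Longrightarrow>
    (\<forall>p h M. S = add_mset (p, h) M \<longrightarrow> m \<le> h \<longrightarrow> inert m M \<longrightarrow> accepts H F p h M)
    \<and> (inert m S \<longrightarrow> S = {#})"
proof (induction rule: vanish.induct)
  case (vanish_step w)
  show ?case
  proof (intro conjI allI impI)
    fix p h M
    assume S: "consumed w = add_mset (p, h) M" and h: "m \<le> h" and M: "inert m M"
    then have "(p, h) \<in># consumed w" by simp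
    then obtain w1 c q w2 where w: "w = w1 @ (c, q) # w2" and c: "(p, h) \<in># shift q (fst c)"
      by (rule in_consumedE)
    let ?v = "w1 @ w2"
    have v: "fst ` set ?v \<subseteq> rules m H F" using vanish_step(1) w by auto
    have eqC: "consumed w = shift q (fst c) + consumed ?v"
      and eqP: "produced w = shift q (snd c) + produced ?v"
      by (simp_all add: w ac_simps)
    have "c \<in> rules m H F" using vanish_step(1) w by auto
    then consider i where "c = ({#(0, i)#}, {#(0, i)#})" "i < m" | "c = ({#(0, F)#}, {#})"
      | k A d k' B where "(k, A, d, k', B) \<in> H" "c = (add_mset (0, k) A, add_mset (d, k') B)"
      by (auto simp: rules_def)
    then show "accepts H F p h M"
    proof cases
      case 1
      then show ?thesis using c h by simp
    next
      case 2
      then have hp: "h = F" "p = q" using c by auto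
      with 2 S eqC have "consumed ?v = M" by simp
      then have "produced ?v = M" using inert_consumed_imp_idle [OF proper v] M by metis
      then have "produced w = M" using eqP 2 by simp
      then have "M = {#}" using vanish_step(3) M by simp
      then show ?thesis using hp by (simp add: accepts_final)
    next
      case 3
      then have kinds: "m \<le> k" "inert m A" "m \<le> k'" "inert m B"
        using proper by (auto simp: proper_def)
      \<comment> \<open>The kinds in \<open>A\<close> are inert, so the token found must be the head
        of the rule itself.\<close>
      then have "(p, h) \<notin># shift q A" using h
        by (metis (no_types, lifting) case_prodD linorder_not_less inert_def inert_simps(4))
      then have hp: "h = k" "p = q" using c 3 by auto
      with 3 S eqC have Meq: "M = consumed ?v + shift q A" by (simp add: ac_simps)
      with M have "inert m (consumed ?v)" by simp
      then have "produced ?v = consumed ?v" by (rule inert_consumed_imp_idle [OF proper v])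
      then have "produced w = add_mset (p + d, k') (consumed ?v + shift q B)"
        using eqP 3 hp by (simp add: ac_simps)
      then have "accepts H F (p + d) k' (consumed ?v + shift q B)"
        using vanish_step(3) kinds \<open>inert m (consumed ?v)\<close> by simp
      then show ?thesis unfolding Meq hp using 3 by (auto intro: accepts_step)
    qed
  next
    assume "inert m (consumed w)"
    then show "consumed w = {#}"
      using inert_consumed_imp_idle [OF proper vanish_step(1)] vanish_step(3) by simp
  qed
qed simp

theorem head_system_iff:
  assumes "proper m H F" "m \<le> h" "inert m M"
  shows "layer t (add_mset (p, h) M) \<in> semimod_gen (gen ` rules m H F) \<longleftrightarrow> accepts H F p h M"
proof -
  have "fst c \<noteq> {#}" if "c \<in> rules m H F" for c
    using that by (auto simp: rules_def)
  then show ?thesis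
    using layer_in_semimod_iff [of "rules m H F"] accepts_imp_vanish [of H F p h M m]
      vanish_imp_accepts [of m H F] assms by blast
qed

section \<open>Counter machines with linear instructions\<close>

type_synonym regs = "nat multiset"
type_synonym linear = "regs \<times> regs \<times> (regs \<times> regs) set"

text \<open>The submonoid generated by \<open>L\<close> in the product of two free commutative
  monoids.\<close>

inductive_set span :: "(regs \<times> regs) set \<Rightarrow> (regs \<times> regs) set" for L where
  span_empty: "({#}, {#}) \<in> span L"
| span_add: "(x, y) \<in> span L \<Longrightarrow> (a, b) \<in> L \<Longrightarrow> (x + a, y + b) \<in> span L"

text \<open>A translate of the additive relation: \<open>a\<close> is taken and \<open>b\<close> is
  added exactly once, and all other tokens are converted by pairs from \<open>L\<close>.\<close>

fun linrel :: "linear \<Rightarrow> (regs \<times> regs) set" where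
  "linrel (a, b, L) = {(a + x, b + y) | x y. (x, y) \<in> span L}"

type_synonym edge = "nat \<times> linear \<times> nat"

definition mstep :: "edge list \<Rightarrow> ((nat \<times> regs) \<times> (nat \<times> regs)) set" where
  "mstep E = {((u, s), (v, s')). \<exists>c. (u, c, v) \<in> set E \<and> (s, s') \<in> linrel c}"

section \<open>Compilation of machine edges into head rules\<close>

definition put :: "int \<Rightarrow> regs \<Rightarrow> tok multiset" where
  "put p s = image_mset (Pair p) s"

text \<open>Above the registers, even offsets are control states and odd offsets are edges in
  progress, so that all head kinds are distinct.\<close>

definition state_kind :: "nat \<Rightarrow> nat \<Rightarrow> nat" where
  "state_kind m u = m + 2 * u"

definition edge_kind :: "nat \<Rightarrow> nat \<Rightarrow> nat" where
  "edge_kind m k = m + 2 * k + 1"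

text \<open>The edge head stays at the old position while it converts tokens there into tokens one
  position ahead, and then follows them. It may leave too early, but stranded tokens make the run
  fail by \<open>accepts_positions\<close>.\<close>

definition edge_rules :: "nat \<Rightarrow> nat \<Rightarrow> edge \<Rightarrow> head_rule set" where
  "edge_rules m k = (\<lambda>(u, (a, b, L), v).
     {(state_kind m u, put 0 a, 0, edge_kind m k, put 1 b),
      (edge_kind m k, {#}, 1, state_kind m v, {#})}
     \<union> (\<lambda>(x, y). (edge_kind m k, put 0 x, 0, edge_kind m k, put 1 y)) ` L)"

definition machine_rules :: "nat \<Rightarrow> edge list \<Rightarrow> head_rule set" where
  "machine_rules m E = (\<Union>k<length E. edge_rules m k (E ! k))"

lemma kind_simps [simp]:
  "state_kind m u = state_kind m v \<longleftrightarrow> u = v"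
  "edge_kind m k = edge_kind m l \<longleftrightarrow> k = l"
  "state_kind m u \<noteq> edge_kind m k" "edge_kind m k \<noteq> state_kind m u"
  "m \<le> state_kind m u" "m \<le> edge_kind m k"
  unfolding state_kind_def edge_kind_def by presburger+

lemma put_simps [simp]:
  "put p {#} = {#}" "put p (add_mset i s) = add_mset (p, i) (put p s)"
  "put p (s + t) = put p s + put p t"
  "shift p (put q s) = put (p + q) s"
  by (simp_all add: put_def shift_def image_mset.compositionality comp_def add.commute)

lemma in_put [simp]: "(q, i) \<in># put p s \<longleftrightarrow> q = p \<and> i \<in># s"
  by (auto simp: put_def)

lemma count_put: "count (put p s) (q, i) = (if q = p then count s i else 0)"
  by (induction s) auto

lemma put_inject [simp]: "put p s = put p t \<longleftrightarrow> s = t"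
  by (metis count_put multiset_eqI)

lemma inert_put: "inert m (put p s) \<longleftrightarrow> set_mset s \<subseteq> {..<m}"
  by (auto simp: inert_def put_def)

text \<open>The positions keep the two parts apart, so \<open>a\<close> can only come out of
  \<open>x\<close>.\<close>

lemma put_cancel:
  assumes eq: "M + put p a = put p x + put q y" and "p \<noteq> q"
  obtains z where "x = z + a" "M = put p z + put q y"
proof -
  have "a \<subseteq># x"
  proof (rule mset_subset_eqI)
    fix i
    have "count (M + put p a) (p, i) = count (put p x + put q y) (p, i)" using eq by simp
    then show "count a i \<le> count x i" using \<open>p \<noteq> q\<close> by (simp add: count_put)
  qed
  then have x: "x = (x - a) + a" by simp
  then have "M + put p a = (put p (x - a) + put q y) + put p a"
    using eq by (metis put_simps(3) add.assoc add.commute)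
  then have "M = put p (x - a) + put q y" by simp
  with x that show ?thesis by blast
qed

lemma edge_in_machine_rulesE:
  assumes "(h, A, d, h', B) \<in> machine_rules m E"
  obtains k u a b L v where "k < length E" "E ! k = (u, (a, b, L), v)"
    "h = state_kind m u" "A = put 0 a" "d = 0" "h' = edge_kind m k" "B = put 1 b"
  | k u a b L v where "k < length E" "E ! k = (u, (a, b, L), v)"
    "h = edge_kind m k" "A = {#}" "d = 1" "h' = state_kind m v" "B = {#}"
  | k u a b L v x y where "k < length E" "E ! k = (u, (a, b, L), v)" "(x, y) \<in> L"
    "h = edge_kind m k" "A = put 0 x" "d = 0" "h' = edge_kind m k" "B = put 1 y"
proof -
  obtain k where k: "k < length E" "(h, A, d, h', B) \<in> edge_rules m k (E ! k)"
    using assms by (auto simp: machine_rules_def)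
  obtain u a b L v where "E ! k = (u, (a, b, L), v)" by (metis prod.exhaust)
  with k that show ?thesis unfolding edge_rules_def by force
qed

lemma machine_rulesI:
  assumes "k < length E" "E ! k = (u, (a, b, L), v)"
  shows "(state_kind m u, put 0 a, 0, edge_kind m k, put 1 b) \<in> machine_rules m E"
    and "(edge_kind m k, {#}, 1, state_kind m v, {#}) \<in> machine_rules m E"
    and "(x, y) \<in> L \<Longrightarrow> (edge_kind m k, put 0 x, 0, edge_kind m k, put 1 y) \<in> machine_rules m E"
  unfolding machine_rules_def using assms by (auto simp: edge_rules_def intro!: bexI [of _ k])

text \<open>This is what makes the transfer of the tokens to the next position complete.\<close>

lemma accepts_positions:
  "accepts (machine_rules m E) F p h M \<Longrightarrow> (q, i) \<in># M \<Longrightarrow> p \<le> q"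
proof (induction rule: accepts.induct)
  case (accepts_step h A d h' B p M)
  from accepts_step(1) have "0 \<le> d \<and> (\<forall>s. s \<in># shift p A \<longrightarrow> p \<le> fst s)"
    by (rule edge_in_machine_rulesE) auto
  with accepts_step(3,4) show ?case by force
qed simp

text \<open>The second conjunct is the invariant of an unfinished transfer: \<open>x\<close> is
  still to be carried, \<open>y\<close> has been delivered, and \<open>z\<close> is what
  \<open>x\<close> will turn into.\<close>

lemma accepts_imp_mstep:
  assumes "accepts (machine_rules m E) (state_kind m f) p h M"
  shows "(\<forall>u s. h = state_kind m u \<longrightarrow> M = put p s \<longrightarrow> ((u, s), (f, {#})) \<in> (mstep E)\<^sup>*)
    \<and> (\<forall>k u a b L v x y. h = edge_kind m k \<longrightarrow> E ! k = (u, (a, b, L), v) \<longrightarrow>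
        M = put p x + put (p + 1) y \<longrightarrow>
        (\<exists>z. (x, z) \<in> span L \<and> ((v, y + z), (f, {#})) \<in> (mstep E)\<^sup>*))"
  using assms
proof (induction rule: accepts.induct)
  case (accepts_final p)
  then show ?case by (metis kind_simps(1,3) put_inject put_simps(1) rtrancl.rtrancl_refl)
next
  case (accepts_step h A d h' B p M)
  note state_IH = accepts_step.IH [THEN conjunct1, rule_format]
  note edge_IH = accepts_step.IH [THEN conjunct2, rule_format]
  from accepts_step(1) show ?case
  proof (cases rule: edge_in_machine_rulesE)
    case (1 k u a b L v)
    have "((u, s), (f, {#})) \<in> (mstep E)\<^sup>*" if M: "M + shift p A = put p s" for s
    proof -
      from M have "M + put p a = put p s + put (p + 1) {#}" using 1 by simp
      then obtain z where z: "s = z + a" "M = put p z" by (rule put_cancel) auto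
      obtain w where w: "(z, w) \<in> span L" "((v, b + w), (f, {#})) \<in> (mstep E)\<^sup>*"
        using edge_IH [OF 1(6,2), of z b] z 1 by auto
      have "(u, (a, b, L), v) \<in> set E" using 1 by (metis nth_mem)
      then have "((u, s), (v, b + w)) \<in> mstep E"
        using w(1) z(1) unfolding mstep_def by (force simp: add.commute)
      with w(2) show ?thesis by (rule converse_rtrancl_into_rtrancl [rotated])
    qed
    then show ?thesis using 1 by auto
  next
    case (2 k u a b L v)
    have "\<exists>z. (x, z) \<in> span L \<and> ((v, y + z), (f, {#})) \<in> (mstep E)\<^sup>*"
      if M: "M = put p x + put (p + 1) y" for x y
    proof -
      \<comment> \<open>The head is about to leave position \<open>p\<close>, and a token of
        \<open>x\<close> would then lie behind it.\<close>
      have "x = {#}"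
      proof (rule ccontr)
        assume "x \<noteq> {#}"
        then obtain i where "i \<in># x" by auto
        then have "p + 1 \<le> p"
          using accepts_positions [OF accepts_step(2), of p i] M 2 by simp
        then show False by simp
      qed
      then have "((v, y), (f, {#})) \<in> (mstep E)\<^sup>*" using state_IH [OF 2(6), of y] M 2 by simp
      with \<open>x = {#}\<close> show ?thesis by (auto intro: exI [of _ "{#}"] span_empty)
    qed
    then show ?thesis using 2 by auto
  next
    case (3 k u a b L v x' y')
    have "\<exists>z. (x, z) \<in> span L \<and> ((v, y + z), (f, {#})) \<in> (mstep E)\<^sup>*"
      if M: "M + shift p A = put p x + put (p + 1) y" for x y
    proof -
      from M have "M + put p x' = put p x + put (p + 1) y" using 3 by simp
      then obtain z where z: "x = z + x'" "M = put p z + put (p + 1) y" by (rule put_cancel) auto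
      then have "M + shift p B = put p z + put (p + 1) (y + y')" using 3 by (simp add: add.commute)
      then obtain w where w: "(z, w) \<in> span L" "((v, y + y' + w), (f, {#})) \<in> (mstep E)\<^sup>*"
        using edge_IH [OF 3(7,2), of z "y + y'"] 3 by auto
      have "(x, w + y') \<in> span L" using span_add [OF w(1) 3(3)] z by simp
      moreover have "y + (w + y') = y + y' + w" by (simp add: ac_simps)
      ultimately show ?thesis using w(2) by metis
    qed
    then show ?thesis using 3 by auto
  qed
qed

text \<open>Here \<open>z\<close> accumulates the tokens already delivered, so it varies along the
  induction.\<close>

lemma transfer_accepts:
  assumes "k < length E" "E ! k = (u, (a, b, L), v)"
  shows "(x, y) \<in> span L \<Longrightarrow> accepts (machine_rules m E) F (p + 1) (state_kind m v) (put (p + 1) (z + y))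
    \<Longrightarrow> accepts (machine_rules m E) F p (edge_kind m k) (put p x + put (p + 1) z)"
proof (induction arbitrary: z rule: span.induct)
  case span_empty
  then show ?case
    using accepts_step [OF machine_rulesI(2) [OF assms], of m F p "put (p + 1) z"] by simp
next
  case (span_add x y c d)
  have "accepts (machine_rules m E) F p (edge_kind m k) (put p x + put (p + 1) (z + d))"
    using span_add.prems by (intro span_add.IH) (simp add: ac_simps)
  then show ?case
    using accepts_step [OF machine_rulesI(3) [OF assms span_add(2)], of m F p "put p x + put (p + 1) z"]
    by (simp add: ac_simps)
qed

text \<open>Every instruction advances the head by one position, so \<open>p\<close> is arbitrary in
  the induction.\<close>

lemma mstep_imp_accepts:
  assumes "((u, s), (f, {#})) \<in> (mstep E)\<^sup>*"
  shows "accepts (machine_rules m E) (state_kind m f) p (state_kind m u) (put p s)"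
  using assms
proof (induction "(u, s)" arbitrary: u s p rule: converse_rtrancl_induct)
  case base
  then show ?case by (simp add: accepts_final)
next
  case (step y u s)
  obtain v s' where y: "y = (v, s')" by (cases y)
  from step(1) obtain a b L where e: "(u, (a, b, L), v) \<in> set E" "(s, s') \<in> linrel (a, b, L)"
    unfolding y mstep_def by auto
  then obtain k where k: "k < length E" "E ! k = (u, (a, b, L), v)" by (meson in_set_conv_nth)
  from e obtain x z where s: "s = a + x" "s' = b + z" "(x, z) \<in> span L" by auto
  have "accepts (machine_rules m E) (state_kind m f) p (edge_kind m k) (put p x + put (p + 1) b)"
    using step(3) [OF y, of "p + 1"] s by (intro transfer_accepts [OF k s(3)]) simp
  then show ?case
    using accepts_step [OF machine_rulesI(1) [OF k], of m "state_kind m f" p "put p x"] s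
    by (simp add: ac_simps)
qed

definition regs_below :: "nat \<Rightarrow> edge list \<Rightarrow> bool" where
  "regs_below m E \<longleftrightarrow> (\<forall>(u, (a, b, L), v) \<in> set E. set_mset a \<subseteq> {..<m} \<and> set_mset b \<subseteq> {..<m}
     \<and> finite L \<and> (\<forall>(x, y) \<in> L. set_mset x \<subseteq> {..<m} \<and> set_mset y \<subseteq> {..<m}))"

lemma proper_machine:
  assumes "regs_below m E"
  shows "proper m (machine_rules m E) (state_kind m f)"
proof -
  have "m \<le> h \<and> inert m A \<and> m \<le> h' \<and> inert m B"
    if "(h, A, d, h', B) \<in> machine_rules m E" for h A d h' B
    using that
  proof (cases rule: edge_in_machine_rulesE)
    case (1 k u a b L v)
    then have "(u, (a, b, L), v) \<in> set E" by (metis nth_mem)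
    with 1 assms show ?thesis by (auto simp: regs_below_def inert_put)
  next
    case (2 k u a b L v)
    then show ?thesis by simp
  next
    case (3 k u a b L v x y)
    then have "(u, (a, b, L), v) \<in> set E" by (metis nth_mem)
    with 3 assms show ?thesis by (fastforce simp: regs_below_def inert_put)
  qed
  then show ?thesis by (auto simp: proper_def)
qed

theorem machine_iff:
  assumes "regs_below m E" "set_mset s \<subseteq> {..<m}"
  shows "layer t (add_mset (p, state_kind m u) (put p s))
      \<in> semimod_gen (gen ` rules m (machine_rules m E) (state_kind m f))
    \<longleftrightarrow> ((u, s), (f, {#})) \<in> (mstep E)\<^sup>*"
  using head_system_iff [OF proper_machine [OF assms(1), of f], of "state_kind m u" "put p s" t p]
    accepts_imp_mstep mstep_imp_accepts assms(2) by (auto simp: inert_put)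

section \<open>Finiteness of the generating set and of the rank\<close>

lemma finite_machine_rules:
  assumes "regs_below m E"
  shows "finite (machine_rules m E)"
proof -
  have "finite (edge_rules m k (E ! k))" if "k < length E" for k
  proof -
    obtain u a b L v where e: "E ! k = (u, (a, b, L), v)" by (metis prod.exhaust)
    then have "(u, (a, b, L), v) \<in> set E" using that by (metis nth_mem)
    then have "finite L" using assms by (auto simp: regs_below_def)
    with e show ?thesis by (simp add: edge_rules_def)
  qed
  then show ?thesis by (simp add: machine_rules_def)
qed

lemma gen_in_free_module:
  assumes "snd ` set_mset (fst c) \<subseteq> {..<k}" "snd ` set_mset (snd c) \<subseteq> {..<k}"
  shows "gen c \<in> free_module k"
proof -
  let ?S = "set_mset (fst c) \<union> set_mset (snd c)"
  have "{q. gen c q \<noteq> 0} \<subseteq> (\<lambda>(t, x, y). ((t, x), y)) ` ({0, 1} \<times> ?S)"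
    by (force simp: gen_def layer_def split: if_splits)
  moreover have "finite ((\<lambda>(t, x, y). ((t, x), y)) ` ({0, 1 :: int} \<times> ?S))" by simp
  ultimately have "finite {q. gen c q \<noteq> 0}" by (rule finite_subset)
  moreover have "gen c ((t, x), y) = 0" if "k \<le> y" for t x y
  proof -
    have "(x, y) \<notin># fst c" "(x, y) \<notin># snd c" using assms that by force+
    then show ?thesis by (simp add: gen_def layer_def not_in_iff)
  qed
  ultimately show ?thesis by (auto simp: free_module_def)
qed

text \<open>The rank exceeds all kinds in the rules and one further kind \<open>n\<close>, later the
  kind of the initial head.\<close>

lemma finite_rules_bound:
  assumes "finite R"
  obtains k where "gen ` R \<subseteq> free_module k" "n < k"
proof -
  let ?K = "insert n (\<Union>c\<in>R. snd ` set_mset (fst c) \<union> snd ` set_mset (snd c))"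
  have fin: "finite ?K" using assms by simp
  show ?thesis
  proof (rule that [of "Suc (Max ?K)"])
    have "y < Suc (Max ?K)" if "y \<in> ?K" for y using Max_ge [OF fin that] by simp
    then show "gen ` R \<subseteq> free_module (Suc (Max ?K))" "n < Suc (Max ?K)"
      by (auto intro!: gen_in_free_module)
  qed
qed

section \<open>Regular programs over counters\<close>

datatype instr = Inc nat | IsZero nat | Add nat nat | Guess nat

text \<open>\<open>Guess n\<close> demands zeros beforehand because none of its pairs consumes a
  register below \<open>n\<close>. Read backwards it erases these registers, and
  \<open>Guess 0\<close> is the identity.\<close>

fun isem :: "instr \<Rightarrow> ((nat \<Rightarrow> nat) \<times> (nat \<Rightarrow> nat)) set" where
  "isem (Inc i) = {(s, s'). s' = s(i := Suc (s i))}"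
| "isem (IsZero i) = {(s, s'). s i = 0 \<and> s' = s}"
| "isem (Add i j) = {(s, s'). s' = s(j := s j + s i)}"
| "isem (Guess n) = {(s, s'). (\<forall>i<n. s i = 0) \<and> (\<forall>i\<ge>n. s' i = s i)}"

fun ibelow :: "nat \<Rightarrow> instr \<Rightarrow> bool" where
  "ibelow m (Inc i) \<longleftrightarrow> i < m"
| "ibelow m (IsZero i) \<longleftrightarrow> i < m"
| "ibelow m (Add i j) \<longleftrightarrow> i < m \<and> j < m \<and> i \<noteq> j"
| "ibelow m (Guess n) \<longleftrightarrow> n \<le> m"

text \<open>The tested register of \<open>IsZero\<close> has no pair and so cannot be carried.
  Copying is linear as well: each carried token of \<open>i\<close> drops an additional token of
  \<open>j\<close>.\<close>

fun ilinear :: "nat \<Rightarrow> instr \<Rightarrow> linear" where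
  "ilinear m (Inc i) = ({#}, {#i#}, (\<lambda>k. ({#k#}, {#k#})) ` {..<m})"
| "ilinear m (IsZero i) = ({#}, {#}, (\<lambda>k. ({#k#}, {#k#})) ` ({..<m} - {i}))"
| "ilinear m (Add i j) = ({#}, {#}, (\<lambda>k. ({#k#}, if k = i then {#i, j#} else {#k#})) ` {..<m})"
| "ilinear m (Guess n) = ({#}, {#}, (\<lambda>k. ({#k#}, {#k#})) ` {n..<m} \<union> (\<lambda>k. ({#}, {#k#})) ` {..<n})"

text \<open>With one image for each kind in \<open>K\<close>, the generated relation is the graph of
  an additive map on multisets over \<open>K\<close>.\<close>

lemma span_graph_iff:
  "(x, y) \<in> span ((\<lambda>k. ({#k#}, g k)) ` K) \<longleftrightarrow> set_mset x \<subseteq> K \<and> y = (\<Sum>k\<in>#x. g k)"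
proof
  show "(x, y) \<in> span ((\<lambda>k. ({#k#}, g k)) ` K) \<Longrightarrow> set_mset x \<subseteq> K \<and> y = (\<Sum>k\<in>#x. g k)"
    by (induction rule: span.induct) auto
next
  have "set_mset x \<subseteq> K \<Longrightarrow> (x, \<Sum>k\<in>#x. g k) \<in> span ((\<lambda>k. ({#k#}, g k)) ` K)"
  proof (induction x)
    case (add k x)
    then have "(x, \<Sum>k\<in>#x. g k) \<in> span ((\<lambda>k. ({#k#}, g k)) ` K)" by simp
    from span_add [OF this, of "{#k#}" "g k"] add.prems show ?case by (simp add: add.commute)
  qed (simp add: span_empty)
  then show "set_mset x \<subseteq> K \<and> y = (\<Sum>k\<in>#x. g k) \<Longrightarrow> (x, y) \<in> span ((\<lambda>k. ({#k#}, g k)) ` K)"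
    by simp
qed

lemma span_add_span: "(x, y) \<in> span L \<Longrightarrow> (a, b) \<in> span L \<Longrightarrow> (x + a, y + b) \<in> span L"
proof (induction rule: span.induct)
  case (span_add x y c d)
  from span.span_add [OF span_add.IH [OF span_add.prems] span_add(2)] show ?case
    by (simp add: ac_simps)
qed simp

lemma span_mono: "(x, y) \<in> span L \<Longrightarrow> L \<subseteq> L' \<Longrightarrow> (x, y) \<in> span L'"
  by (induction rule: span.induct) (auto intro: span.intros)

lemma span_guess_iff:
  assumes "n \<le> m"
  shows "(x, y) \<in> span ((\<lambda>k. ({#k#}, {#k#})) ` {n..<m} \<union> (\<lambda>k. ({#}, {#k#})) ` {..<n})
    \<longleftrightarrow> set_mset x \<subseteq> {n..<m} \<and> (\<exists>z. set_mset z \<subseteq> {..<n} \<and> y = x + z)"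
    (is "_ \<in> span (?L \<union> ?G) \<longleftrightarrow> _")
proof
  assume "(x, y) \<in> span (?L \<union> ?G)"
  then show "set_mset x \<subseteq> {n..<m} \<and> (\<exists>z. set_mset z \<subseteq> {..<n} \<and> y = x + z)"
  proof (induction rule: span.induct)
    case (span_add x y a b)
    then obtain z where z: "set_mset z \<subseteq> {..<n}" "y = x + z" by auto
    from span_add(2) show ?case
    proof
      assume "(a, b) \<in> ?L"
      then show ?thesis using z span_add by auto
    next
      assume "(a, b) \<in> ?G"
      then obtain k where "k < n" "a = {#}" "b = {#k#}" by auto
      then show ?thesis using z span_add by (auto intro!: exI [of _ "add_mset k z"])
    qed
  qed simp
next
  assume "set_mset x \<subseteq> {n..<m} \<and> (\<exists>z. set_mset z \<subseteq> {..<n} \<and> y = x + z)"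
  then obtain z where x: "set_mset x \<subseteq> {n..<m}" and z: "set_mset z \<subseteq> {..<n}" and y: "y = x + z"
    by blast
  have "(x, x) \<in> span ?L" using x by (subst span_graph_iff) simp
  then have 1: "(x, x) \<in> span (?L \<union> ?G)" by (rule span_mono) simp
  have "({#}, z) \<in> span (?L \<union> ?G)" using z
  proof (induction z)
    case (add k z)
    then have "({#}, z) \<in> span (?L \<union> ?G)" by simp
    from span_add [OF this, of "{#}" "{#k#}"] add.prems show ?case by simp
  qed (simp add: span_empty)
  from span_add_span [OF 1 this] y show "(x, y) \<in> span (?L \<union> ?G)" by simp
qed

lemma sum_mset_add_graph:
  "(\<Sum>k\<in>#x. if k = i then {#i, j#} else {#k#}) = x + replicate_mset (count x i) j"
  by (induction x) auto

lemma linrel_ilinear_iff: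
  assumes "ibelow m c"
  shows "(x, y) \<in> linrel (ilinear m c) \<longleftrightarrow>
    set_mset x \<subseteq> {..<m} \<and> set_mset y \<subseteq> {..<m} \<and> (count x, count y) \<in> isem c"
proof (cases c)
  case (Inc i)
  then have "(x, y) \<in> linrel (ilinear m c) \<longleftrightarrow> set_mset x \<subseteq> {..<m} \<and> y = add_mset i x"
    by (auto simp: span_graph_iff)
  also have "y = add_mset i x \<longleftrightarrow> count y = (count x)(i := Suc (count x i))"
    by (auto simp: multiset_eq_iff fun_eq_iff)
  finally show ?thesis using Inc assms
    by (auto simp: \<open>(y = add_mset i x) = _\<close> [symmetric])
next
  case (IsZero i)
  then have "(x, y) \<in> linrel (ilinear m c) \<longleftrightarrow> set_mset x \<subseteq> {..<m} - {i} \<and> y = x"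
    by (auto simp: span_graph_iff)
  also have "\<dots> \<longleftrightarrow> set_mset x \<subseteq> {..<m} \<and> count x i = 0 \<and> y = x"
    by (auto simp: count_eq_zero_iff)
  finally show ?thesis using IsZero by (auto simp: count_inject)
next
  case (Add i j)
  then have "(x, y) \<in> linrel (ilinear m c) \<longleftrightarrow>
      set_mset x \<subseteq> {..<m} \<and> y = x + replicate_mset (count x i) j"
    by (auto simp: span_graph_iff sum_mset_add_graph)
  also have "y = x + replicate_mset (count x i) j \<longleftrightarrow> count y = (count x)(j := count x j + count x i)"
    by (auto simp: multiset_eq_iff fun_eq_iff)
  finally show ?thesis using Add assms
    by (auto simp: \<open>(y = x + replicate_mset (count x i) j) = _\<close> [symmetric] split: if_splits)
next
  case (Guess n)
  then have "(x, y) \<in> linrel (ilinear m c) \<longleftrightarrow>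
      set_mset x \<subseteq> {n..<m} \<and> (\<exists>z. set_mset z \<subseteq> {..<n} \<and> y = x + z)"
    using span_guess_iff [of n m x y] assms by (auto simp del: image_Un)
  also have "\<dots> \<longleftrightarrow> set_mset x \<subseteq> {..<m} \<and> set_mset y \<subseteq> {..<m} \<and>
      (\<forall>i<n. count x i = 0) \<and> (\<forall>i\<ge>n. count y i = count x i)" (is "?l \<longleftrightarrow> ?r")
  proof
    assume ?l
    then obtain z where z: "set_mset x \<subseteq> {n..<m}" "set_mset z \<subseteq> {..<n}" "y = x + z" by auto
    then have "i \<notin># x" if "i < n" for i using that by auto
    moreover have "i \<notin># z" if "n \<le> i" for i using that z by auto
    ultimately show ?r using z assms Guess by (auto simp: not_in_iff)
  next
    assume r: ?r
    then have x: "set_mset x \<subseteq> {n..<m}"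
      by (auto simp: subset_iff) (metis count_eq_zero_iff not_le)
    have "x \<subseteq># y"
    proof (rule mset_subset_eqI)
      fix i show "count x i \<le> count y i" using r by (cases "i < n") auto
    qed
    then have "y = x + (y - x)" by simp
    moreover have "set_mset (y - x) \<subseteq> {..<n}"
    proof
      fix i assume "i \<in># y - x"
      then have "count x i < count y i" by (simp add: in_diff_count)
      then show "i \<in> {..<n}" using r by (cases "i < n") auto
    qed
    ultimately show ?l using x by blast
  qed
  finally show ?thesis using Guess by auto
qed

section \<open>Regular programs with converse instructions\<close>

datatype prog = Atom bool instr | Seq prog prog | Alt prog prog | Star prog

text \<open>The flag selects the converse. This supplies the missing operations: \<open>Inc\<close>
  backwards is a decrement that is blocked at zero.\<close>

definition csem :: "bool \<times> instr \<Rightarrow> ((nat \<Rightarrow> nat) \<times> (nat \<Rightarrow> nat)) set" where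
  "csem c = (if fst c then (isem (snd c))\<inverse> else isem (snd c))"

fun sem :: "prog \<Rightarrow> ((nat \<Rightarrow> nat) \<times> (nat \<Rightarrow> nat)) set" where
  "sem (Atom b c) = csem (b, c)"
| "sem (Seq p q) = sem p O sem q"
| "sem (Alt p q) = sem p \<union> sem q"
| "sem (Star p) = (sem p)\<^sup>*"

fun below :: "nat \<Rightarrow> prog \<Rightarrow> bool" where
  "below m (Atom b c) \<longleftrightarrow> ibelow m c"
| "below m (Seq p q) \<longleftrightarrow> below m p \<and> below m q"
| "below m (Alt p q) \<longleftrightarrow> below m p \<and> below m q"
| "below m (Star p) \<longleftrightarrow> below m p"

definition clinear :: "nat \<Rightarrow> bool \<times> instr \<Rightarrow> linear" where
  "clinear m c = (case ilinear m (snd c) of (a, b, L) \<Rightarrow> if fst c then (b, a, L\<inverse>) else (a, b, L))"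

lemma span_converse: "(x, y) \<in> span (L\<inverse>) \<longleftrightarrow> (y, x) \<in> span L"
proof -
  have "(x, y) \<in> span L \<Longrightarrow> (y, x) \<in> span (L\<inverse>)" for x y L
    by (induction rule: span.induct) (auto intro: span.intros)
  then show ?thesis by (metis converse_converse)
qed

lemma linrel_clinear_iff:
  assumes "ibelow m (snd c)"
  shows "(x, y) \<in> linrel (clinear m c) \<longleftrightarrow>
    set_mset x \<subseteq> {..<m} \<and> set_mset y \<subseteq> {..<m} \<and> (count x, count y) \<in> csem c"
proof -
  obtain a b L where l: "ilinear m (snd c) = (a, b, L)" by (metis prod.exhaust)
  have "(x, y) \<in> linrel (clinear m c) \<longleftrightarrow>
      (if fst c then (y, x) \<in> linrel (a, b, L) else (x, y) \<in> linrel (a, b, L))"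
    by (auto simp: clinear_def l span_converse)
  then show ?thesis
    using linrel_ilinear_iff [OF assms] by (auto simp: l csem_def simp del: linrel.simps)
qed

lemma regs_below_clinear:
  assumes "\<And>u c v. (u, c, v) \<in> set E \<Longrightarrow> ibelow m (snd c)"
  shows "regs_below m (map (\<lambda>(u, c, v). (u, clinear m c, v)) E)"
proof -
  have *: "case ilinear m c of (a, b, L) \<Rightarrow> set_mset a \<subseteq> {..<m} \<and> set_mset b \<subseteq> {..<m} \<and> finite L \<and>
      (\<forall>(x, y) \<in> L. set_mset x \<subseteq> {..<m} \<and> set_mset y \<subseteq> {..<m})" if "ibelow m c" for c
    using that by (cases c) auto
  show ?thesis
    using assms * by (fastforce simp: regs_below_def clinear_def split: prod.splits if_splits)
qed

text \<open>This keeps the valuations along a run finitely supported, so that they are counts of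
  multisets over the kinds below \<open>m\<close>.\<close>

lemma csem_bounded:
  assumes "(f, f') \<in> csem c" "ibelow m (snd c)" "\<forall>i\<ge>m. f i = 0"
  shows "\<forall>i\<ge>m. f' i = 0"
  using assms by (cases "snd c") (auto simp: csem_def fun_eq_iff split: if_splits)

lemma ex_count:
  assumes "\<forall>i\<ge>m. f i = 0"
  obtains x where "f = count x" "set_mset x \<subseteq> {..<m :: nat}"
proof -
  have "i < m" if "0 < f i" for i using that assms by (metis less_irrefl not_le)
  then have "finite {i. 0 < f i}" by (auto intro: finite_subset [of _ "{..<m}"])
  then have "f = count (Abs_multiset f)" by simp
  moreover from this have "set_mset (Abs_multiset f) \<subseteq> {..<m}"
    using assms by (metis count_eq_zero_iff lessThan_iff not_le subsetI)
  ultimately show ?thesis by (rule that)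
qed

section \<open>Automata for regular programs\<close>

definition nstep :: "(nat \<times> (bool \<times> instr) \<times> nat) set \<Rightarrow> ((nat \<times> (nat \<Rightarrow> nat)) \<times> (nat \<times> (nat \<Rightarrow> nat))) set" where
  "nstep E = {((u, s), (v, s')). \<exists>c. (u, c, v) \<in> E \<and> (s, s') \<in> csem c}"

lemma nstep_iff_mstep:
  assumes E: "\<And>u c v. (u, c, v) \<in> set E \<Longrightarrow> ibelow m (snd c)" and x: "set_mset x \<subseteq> {..<m}"
  shows "((u, x), (v, {#})) \<in> (mstep (map (\<lambda>(u, c, v). (u, clinear m c, v)) E))\<^sup>*
    \<longleftrightarrow> ((u, count x), (v, \<lambda>_. 0)) \<in> (nstep (set E))\<^sup>*" (is "_ \<in> ?M\<^sup>* \<longleftrightarrow> _")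
proof
  assume "((u, x), (v, {#})) \<in> ?M\<^sup>*"
  then have "((u, count x), (v, count {#})) \<in> (nstep (set E))\<^sup>*"
  proof (induction "(u, x)" arbitrary: u x rule: converse_rtrancl_induct)
    case (step q u x)
    obtain w y where q: "q = (w, y)" by (cases q)
    from step(1) obtain c where "(u, c, w) \<in> set E" "(x, y) \<in> linrel (clinear m c)"
      unfolding q mstep_def by (auto simp del: linrel.simps)
    with E linrel_clinear_iff have "((u, count x), (w, count y)) \<in> nstep (set E)"
      unfolding nstep_def by blast
    with step(3) [OF q] show ?case by (rule converse_rtrancl_into_rtrancl [rotated])
  qed simp
  then show "((u, count x), (v, \<lambda>_. 0)) \<in> (nstep (set E))\<^sup>*" by (simp add: zero_multiset.rep_eq)
next
  have "((u, f), (v, \<lambda>_. 0)) \<in> (nstep (set E))\<^sup>* \<Longrightarrow> \<forall>x. f = count x \<longrightarrow> set_mset x \<subseteq> {..<m} \<longrightarrow>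
      ((u, x), (v, {#})) \<in> ?M\<^sup>*" for f
  proof (induction "(u, f)" arbitrary: u f rule: converse_rtrancl_induct)
    case base
    have "x = {#}" if "(\<lambda>_. 0) = count x" for x :: regs
      using that by (metis count_empty multiset_eqI)
    then show ?case by auto
  next
    case (step q u f)
    obtain w g where q: "q = (w, g)" by (cases q)
    show ?case
    proof (intro allI impI)
      fix x assume f: "f = count x" and x: "set_mset x \<subseteq> {..<m}"
      from step(1) obtain c where c: "(u, c, w) \<in> set E" "(f, g) \<in> csem c"
        unfolding q nstep_def by auto
      have "\<forall>i\<ge>m. f i = 0" using f x by (metis count_eq_zero_iff lessThan_iff not_le subsetD)
      then have "\<forall>i\<ge>m. g i = 0" using csem_bounded [OF c(2)] E [OF c(1)] by blast
      then obtain y where y: "g = count y" "set_mset y \<subseteq> {..<m}" by (rule ex_count)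
      then have "(x, y) \<in> linrel (clinear m c)"
        using linrel_clinear_iff [OF E [OF c(1)]] c(2) f x by blast
      moreover have "(u, clinear m c, w) \<in> set (map (\<lambda>(u, c, v). (u, clinear m c, v)) E)"
        using image_eqI [OF _ c(1), of _ "\<lambda>(u, c, v). (u, clinear m c, v)"] by simp
      ultimately have "((u, x), (w, y)) \<in> ?M" unfolding mstep_def by blast
      moreover have "((w, y), (v, {#})) \<in> ?M\<^sup>*" using step(3) [OF q] y by blast
      ultimately show "((u, x), (v, {#})) \<in> ?M\<^sup>*" by (rule converse_rtrancl_into_rtrancl)
    qed
  qed
  then show "((u, count x), (v, \<lambda>_. 0)) \<in> (nstep (set E))\<^sup>* \<Longrightarrow> ((u, x), (v, {#})) \<in> ?M\<^sup>*"
    using x by blast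
qed

lemma nstepI: "(u, c, v) \<in> E \<Longrightarrow> (s, s') \<in> csem c \<Longrightarrow> ((u, s), (v, s')) \<in> nstep E"
  unfolding nstep_def by blast

lemma nstep_mono: "E \<subseteq> E' \<Longrightarrow> nstep E \<subseteq> nstep E'"
  unfolding nstep_def by blast

lemma nstep_rtrancl_mono: "q \<in> (nstep E)\<^sup>* \<Longrightarrow> E \<subseteq> E' \<Longrightarrow> q \<in> (nstep E')\<^sup>*"
  using rtrancl_mono [OF nstep_mono] by blast

abbreviation skip :: "bool \<times> instr" where
  "skip \<equiv> (False, Guess 0)"

lemma csem_skip [simp]: "csem skip = Id"
  by (auto simp: csem_def)

text \<open>\<open>I\<close> attaches an inductive assertion in the sense of Floyd to every control
  state.\<close>

definition preserves :: "(nat \<Rightarrow> (nat \<Rightarrow> nat) set) \<Rightarrow> (nat \<times> (bool \<times> instr) \<times> nat) set \<Rightarrow> bool" where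
  "preserves I E \<longleftrightarrow> (\<forall>(u, c, v) \<in> E. csem c `` I u \<subseteq> I v)"

definition edges_in :: "nat \<Rightarrow> nat set \<Rightarrow> (nat \<times> (bool \<times> instr) \<times> nat) set \<Rightarrow> bool" where
  "edges_in m A E \<longleftrightarrow> (\<forall>(x, c, y) \<in> E. ibelow m (snd c) \<and> x \<in> A \<and> y \<in> A)"

lemma edges_in_Un [simp]: "edges_in m A (E \<union> E') \<longleftrightarrow> edges_in m A E \<and> edges_in m A E'"
  unfolding edges_in_def by (rule ball_Un)

lemma edges_in_mono: "edges_in m A E \<Longrightarrow> A \<subseteq> A' \<Longrightarrow> edges_in m A' E"
  unfolding edges_in_def by fastforce

text \<open>Soundness of the automaton is stated by means of invariants: every pre- and postcondition
  of the program extends to an inductive assignment of the states.\<close>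

definition implements ::
  "nat \<Rightarrow> prog \<Rightarrow> nat \<Rightarrow> nat \<Rightarrow> nat \<Rightarrow> (nat \<times> (bool \<times> instr) \<times> nat) set \<Rightarrow> nat \<Rightarrow> bool" where
  "implements m p u v n E n' \<longleftrightarrow> n \<le> n' \<and> finite E \<and> edges_in m ({u, v} \<union> {n..<n'}) E
     \<and> (\<forall>s s'. (s, s') \<in> sem p \<longrightarrow> ((u, s), (v, s')) \<in> (nstep E)\<^sup>*)
     \<and> (\<forall>X Y. sem p `` X \<subseteq> Y \<longrightarrow> (u = v \<longrightarrow> X = Y) \<longrightarrow> (\<exists>I. I u = X \<and> I v = Y \<and> preserves I E))"

lemma preserves_cong:
  assumes "preserves I E" "\<And>x c y. (x, c, y) \<in> E \<Longrightarrow> J x = I x \<and> J y = I y"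
  shows "preserves J E"
  using assms unfolding preserves_def by fastforce

lemma preserves_Un [simp]: "preserves I (E \<union> E') \<longleftrightarrow> preserves I E \<and> preserves I E'"
  unfolding preserves_def by (rule ball_Un)

lemma implementsD:
  assumes "implements m p u v n E n'"
  shows "n \<le> n'" "finite E"
    "edges_in m ({u, v} \<union> {n..<n'}) E"
    "(x, c, y) \<in> E \<Longrightarrow> x \<in> {u, v} \<union> {n..<n'} \<and> y \<in> {u, v} \<union> {n..<n'}"
    "(s, s') \<in> sem p \<Longrightarrow> ((u, s), (v, s')) \<in> (nstep E)\<^sup>*"
    "sem p `` X \<subseteq> Y \<Longrightarrow> (u = v \<Longrightarrow> X = Y) \<Longrightarrow> \<exists>I. I u = X \<and> I v = Y \<and> preserves I E"
proof -
  note a = assms [unfolded implements_def]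
  show "n \<le> n'" using a by (elim conjE)
  show "finite E" using a by (elim conjE)
  show edges: "edges_in m ({u, v} \<union> {n..<n'}) E" using a by (elim conjE)
  show "x \<in> {u, v} \<union> {n..<n'} \<and> y \<in> {u, v} \<union> {n..<n'}" if "(x, c, y) \<in> E"
    using bspec [OF edges [unfolded edges_in_def] that] by simp
  have "\<forall>s s'. (s, s') \<in> sem p \<longrightarrow> ((u, s), (v, s')) \<in> (nstep E)\<^sup>*" using a by (elim conjE)
  then show "(s, s') \<in> sem p \<Longrightarrow> ((u, s), (v, s')) \<in> (nstep E)\<^sup>*" by blast
  have "\<forall>X Y. sem p `` X \<subseteq> Y \<longrightarrow> (u = v \<longrightarrow> X = Y) \<longrightarrow> (\<exists>I. I u = X \<and> I v = Y \<and> preserves I E)"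
    using a by (elim conjE)
  then show "sem p `` X \<subseteq> Y \<Longrightarrow> (u = v \<Longrightarrow> X = Y) \<Longrightarrow> \<exists>I. I u = X \<and> I v = Y \<and> preserves I E"
    by blast
qed

lemma implements_mono:
  assumes "implements m p u v n E n'" "(s, s') \<in> sem p" "E \<subseteq> E'"
  shows "((u, s), (v, s')) \<in> (nstep E')\<^sup>*"
  using implementsD(5) [OF assms(1,2)] assms(3) by (rule nstep_rtrancl_mono)

text \<open>This is Thompson's construction of an automaton from a regular expression; the states
  from \<open>n\<close> up to, but excluding, \<open>n'\<close> are fresh. The endpoints may
  coincide, as the loop for \<open>Star\<close> requires, and then pre- and postcondition are one
  assertion.\<close>

lemma implements_ex:
  "below m p \<Longrightarrow> u < n \<Longrightarrow> v < n \<Longrightarrow> \<exists>E n'. implements m p u v n E n'"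
proof (induction p arbitrary: u v n)
  case (Atom b c)
  have "\<exists>I. I u = X \<and> I v = Y \<and> preserves I {(u, (b, c), v)}"
    if "csem (b, c) `` X \<subseteq> Y" "u = v \<longrightarrow> X = Y" for X Y
    using that by (intro exI [of _ "(\<lambda>_. Y)(u := X)"]) (auto simp: preserves_def)
  moreover have "((u, s), (v, s')) \<in> (nstep {(u, (b, c), v)})\<^sup>*" if "(s, s') \<in> csem (b, c)" for s s'
    using that by (intro r_into_rtrancl) (simp add: nstep_def)
  ultimately have "implements m (Atom b c) u v n {(u, (b, c), v)} n"
    using Atom by (auto simp: implements_def edges_in_def)
  then show ?case by blast
next
  case (Seq p q)
  \<comment> \<open>The fresh state \<open>n\<close> joins the two automata.\<close>
  from Seq.IH(1) [of u "Suc n" n] Seq.prems obtain E1 n1 where 1: "implements m p u n (Suc n) E1 n1"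
    by auto
  then have "n < n1" by (simp add: implements_def)
  with Seq.IH(2) [of n n1 v] Seq.prems obtain E2 n2 where 2: "implements m q n v n1 E2 n2"
    by auto
  have "((u, s), (v, s'')) \<in> (nstep (E1 \<union> E2))\<^sup>*" if "(s, s') \<in> sem p" "(s', s'') \<in> sem q" for s s' s''
  proof -
    have "((u, s), (n, s')) \<in> (nstep (E1 \<union> E2))\<^sup>*" using 1 that(1) by (rule implements_mono) simp
    also have "((n, s'), (v, s'')) \<in> (nstep (E1 \<union> E2))\<^sup>*" using 2 that(2) by (rule implements_mono) simp
    finally show ?thesis .
  qed
  moreover have "\<exists>I. I u = X \<and> I v = Y \<and> preserves I (E1 \<union> E2)"
    if XY: "sem (Seq p q) `` X \<subseteq> Y" "u = v \<longrightarrow> X = Y" for X Y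
  proof -
    \<comment> \<open>The assertion at the junction is the exact image of \<open>X\<close> under
      \<open>sem p\<close>.\<close>
    obtain I1 where I1: "I1 u = X" "I1 n = sem p `` X" "preserves I1 E1"
      using implementsD(6) [OF 1, of X "sem p `` X"] Seq.prems by auto
    have "sem q `` (sem p `` X) \<subseteq> Y" using XY by auto
    then obtain I2 where I2: "I2 n = sem p `` X" "I2 v = Y" "preserves I2 E2"
      using implementsD(6) [OF 2, of "sem p `` X" Y] Seq.prems by auto
    let ?I = "\<lambda>x. if x = u then X else if x = v then Y else if x < n1 then I1 x else I2 x"
    have "preserves ?I E1"
    proof (rule preserves_cong [OF I1(3)])
      fix x c y assume "(x, c, y) \<in> E1"
      then have "x \<in> {u, n} \<union> {Suc n..<n1}" "y \<in> {u, n} \<union> {Suc n..<n1}"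
        using implementsD(4) [OF 1] by blast+
      then show "?I x = I1 x \<and> ?I y = I1 y" using Seq.prems I1 \<open>n < n1\<close> by auto
    qed
    moreover have "preserves ?I E2"
    proof (rule preserves_cong [OF I2(3)])
      fix x c y assume "(x, c, y) \<in> E2"
      then have "x \<in> {n, v} \<union> {n1..<n2}" "y \<in> {n, v} \<union> {n1..<n2}"
        using implementsD(4) [OF 2] by blast+
      then show "?I x = I2 x \<and> ?I y = I2 y" using Seq.prems I1 I2 XY(2) \<open>n < n1\<close> by auto
    qed
    ultimately show ?thesis using XY(2) by (intro exI [of _ ?I]) auto
  qed
  moreover have "n \<le> n2" "finite (E1 \<union> E2)"
    using implementsD(1,2) [OF 1] implementsD(1,2) [OF 2] by auto
  moreover have "edges_in m ({u, v} \<union> {n..<n2}) (E1 \<union> E2)"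
  proof -
    have "{u, n} \<union> {Suc n..<n1} \<subseteq> {u, v} \<union> {n..<n2}" "{n, v} \<union> {n1..<n2} \<subseteq> {u, v} \<union> {n..<n2}"
      using \<open>n < n1\<close> implementsD(1) [OF 2] by auto
    then show ?thesis
      using edges_in_mono [OF implementsD(3) [OF 1]] edges_in_mono [OF implementsD(3) [OF 2]] by simp
  qed
  ultimately have "implements m (Seq p q) u v n (E1 \<union> E2) n2"
    unfolding implements_def by auto
  then show ?case by blast
next
  case (Alt p q)
  from Alt.IH(1) [of u n v] Alt.prems obtain E1 n1 where 1: "implements m p u v n E1 n1" by auto
  then have "n \<le> n1" by (simp add: implements_def)
  with Alt.IH(2) [of u n1 v] Alt.prems obtain E2 n2 where 2: "implements m q u v n1 E2 n2" by auto
  have "\<exists>I. I u = X \<and> I v = Y \<and> preserves I (E1 \<union> E2)"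
    if XY: "sem (Alt p q) `` X \<subseteq> Y" "u = v \<longrightarrow> X = Y" for X Y
  proof -
    have "sem p `` X \<subseteq> Y" "sem q `` X \<subseteq> Y" using XY by auto
    then obtain I1 I2 where I1: "I1 u = X" "I1 v = Y" "preserves I1 E1"
      and I2: "I2 u = X" "I2 v = Y" "preserves I2 E2"
      using implementsD(6) [OF 1, of X Y] implementsD(6) [OF 2, of X Y] XY(2) by blast
    \<comment> \<open>The automata share only the states \<open>u\<close> and \<open>v\<close>,
      where both assignments take the values \<open>X\<close> and \<open>Y\<close>.\<close>
    let ?I = "\<lambda>x. if x < n1 then I1 x else I2 x"
    have "preserves ?I E1"
    proof (rule preserves_cong [OF I1(3)])
      fix x c y assume "(x, c, y) \<in> E1"
      then have "x \<in> {u, v} \<union> {n..<n1}" "y \<in> {u, v} \<union> {n..<n1}"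
        using implementsD(4) [OF 1] by blast+
      then show "?I x = I1 x \<and> ?I y = I1 y" using Alt.prems \<open>n \<le> n1\<close> by auto
    qed
    moreover have "preserves ?I E2"
    proof (rule preserves_cong [OF I2(3)])
      fix x c y assume "(x, c, y) \<in> E2"
      then have "x \<in> {u, v} \<union> {n1..<n2}" "y \<in> {u, v} \<union> {n1..<n2}"
        using implementsD(4) [OF 2] by blast+
      then show "?I x = I2 x \<and> ?I y = I2 y" using Alt.prems I1 I2 \<open>n \<le> n1\<close> by auto
    qed
    ultimately show ?thesis using I1 Alt.prems \<open>n \<le> n1\<close> by (intro exI [of _ ?I]) auto
  qed
  moreover have "n \<le> n2" "finite (E1 \<union> E2)"
    using implementsD(1,2) [OF 1] implementsD(1,2) [OF 2] by auto
  moreover have "edges_in m ({u, v} \<union> {n..<n2}) (E1 \<union> E2)"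
  proof -
    have "{u, v} \<union> {n..<n1} \<subseteq> {u, v} \<union> {n..<n2}" "{u, v} \<union> {n1..<n2} \<subseteq> {u, v} \<union> {n..<n2}"
      using \<open>n \<le> n1\<close> implementsD(1) [OF 2] by auto
    then show ?thesis
      using edges_in_mono [OF implementsD(3) [OF 1]] edges_in_mono [OF implementsD(3) [OF 2]] by simp
  qed
  moreover have "((u, s), (v, s')) \<in> (nstep (E1 \<union> E2))\<^sup>*" if "(s, s') \<in> sem (Alt p q)" for s s'
    using implements_mono [OF 1, of s s' "E1 \<union> E2"] implements_mono [OF 2, of s s' "E1 \<union> E2"] that
    by auto
  ultimately have "implements m (Alt p q) u v n (E1 \<union> E2) n2"
    unfolding implements_def by blast
  then show ?case by blast
next
  case (Star p)
  from Star.IH [of n "Suc n" n] Star.prems obtain E n' where 1: "implements m p n n (Suc n) E n'"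
    by auto
  \<comment> \<open>The loop runs at a fresh state that is entered and left by skips, so that its
    iterations cannot mix with surrounding edges at \<open>u\<close> or \<open>v\<close>.\<close>
  let ?E = "E \<union> {(u, skip, n), (n, skip, v)}"
  have "((u, s), (v, s')) \<in> (nstep ?E)\<^sup>*" if "(s, s') \<in> sem (Star p)" for s s'
  proof -
    from that have "((n, s), (n, s')) \<in> (nstep ?E)\<^sup>*" unfolding sem.simps
    proof (induction rule: rtrancl_induct)
      case (step s' s'')
      then have "((n, s'), (n, s'')) \<in> (nstep ?E)\<^sup>*" by (intro implements_mono [OF 1]) auto
      with step(3) show ?case by simp
    qed simp
    moreover have "((u, s), (n, s)) \<in> nstep ?E" "((n, s'), (v, s')) \<in> nstep ?E"
      by (rule nstepI [of _ skip], simp_all)+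
    ultimately show ?thesis by (meson converse_rtrancl_into_rtrancl rtrancl.rtrancl_into_rtrancl)
  qed
  moreover have "\<exists>I. I u = X \<and> I v = Y \<and> preserves I ?E"
    if XY: "sem (Star p) `` X \<subseteq> Y" "u = v \<longrightarrow> X = Y" for X Y
  proof -
    \<comment> \<open>The loop invariant: everything reachable from \<open>X\<close> by iteration.
      It serves as both pre- and postcondition of the body.\<close>
    let ?Z = "sem (Star p) `` X"
    have "sem p `` ?Z \<subseteq> ?Z" by (auto intro: rtrancl_into_rtrancl)
    then obtain I1 where I1: "I1 n = ?Z" "preserves I1 E"
      using implementsD(6) [OF 1, of ?Z ?Z] by auto
    let ?I = "I1(v := Y, u := X)"
    have "preserves ?I E"
    proof (rule preserves_cong [OF I1(2)])
      fix x c y assume "(x, c, y) \<in> E"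
      then have "x \<in> {n..<n'} \<union> {n}" "y \<in> {n..<n'} \<union> {n}"
        using implementsD(1) [OF 1] implementsD(4) [OF 1] by fastforce+
      then show "?I x = I1 x \<and> ?I y = I1 y" using Star.prems by auto
    qed
    moreover have "preserves ?I {(u, skip, n), (n, skip, v)}"
      using XY Star.prems I1 by (auto simp: preserves_def)
    ultimately have "preserves ?I ?E" by (simp only: preserves_Un)
    moreover have "?I u = X" "?I v = Y" using XY(2) by auto
    ultimately show ?thesis by blast
  qed
  moreover have "n \<le> n'" "finite ?E" using implementsD(1,2) [OF 1] by auto
  moreover have "edges_in m ({u, v} \<union> {n..<n'}) ?E"
  proof -
    have "{n, n} \<union> {Suc n..<n'} \<subseteq> {u, v} \<union> {n..<n'}" "n < n'"
      using implementsD(1) [OF 1] by auto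
    then have "edges_in m ({u, v} \<union> {n..<n'}) E"
      "edges_in m ({u, v} \<union> {n..<n'}) {(u, skip, n), (n, skip, v)}"
      using edges_in_mono [OF implementsD(3) [OF 1]] by (simp_all only:) (simp_all add: edges_in_def)
    then show ?thesis by (simp only: edges_in_Un)
  qed
  ultimately have "implements m (Star p) u v n ?E n'"
    unfolding implements_def by blast
  then show ?case by blast
qed

text \<open>For soundness, the precondition is the single valuation \<open>s\<close> and the
  postcondition is its image; as the endpoints differ, the two need not be equal.\<close>

lemma implements_iff:
  assumes "implements m p u v n E n'" "u \<noteq> v"
  shows "((u, s), (v, s')) \<in> (nstep E)\<^sup>* \<longleftrightarrow> (s, s') \<in> sem p"
proof
  assume steps: "((u, s), (v, s')) \<in> (nstep E)\<^sup>*"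
  from assms obtain I where I: "I u = {s}" "I v = sem p `` {s}" "preserves I E"
    using implementsD(6) [OF assms(1), of "{s}" "sem p `` {s}"] by blast
  from steps have "snd (v, s') \<in> I (fst (v, s'))"
  proof (induction rule: rtrancl_induct)
    case (step q r)
    then show ?case using I(3) by (force simp: nstep_def preserves_def)
  qed (simp add: I)
  then show "(s, s') \<in> sem p" using I by simp
qed (rule implementsD(5) [OF assms(1)])

theorem program_semimodule:
  assumes "below m p"
  obtains k B h where "finite B" "B \<subseteq> free_module k" "m \<le> h" "h < k"
    "\<And>x. set_mset x \<subseteq> {..<m} \<Longrightarrow>
      layer 0 (add_mset (0, h) (put 0 x)) \<in> semimod_gen B \<longleftrightarrow> (count x, \<lambda>_. 0) \<in> sem p"
proof -
  \<comment> \<open>State 0 is initial and state 1 final, so fresh states start at 2.\<close>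
  obtain E n' where E: "implements m p 0 1 2 E n'"
    using implements_ex [OF assms, of 0 2 1] by auto
  then have "finite E" by (simp add: implements_def)
  then obtain es where es: "set es = E" using finite_list by blast
  let ?M = "map (\<lambda>(u, c, v). (u, clinear m c, v)) es"
  have ib: "\<And>u c v. (u, c, v) \<in> set es \<Longrightarrow> ibelow m (snd c)"
    using bspec [OF implementsD(3) [OF E, unfolded edges_in_def]] es by fastforce
  then have M: "regs_below m ?M" by (rule regs_below_clinear)
  let ?R = "rules m (machine_rules m ?M) (state_kind m 1)"
  have "finite ?R" using finite_machine_rules [OF M] by (simp add: rules_def)
  then obtain k where k: "gen ` ?R \<subseteq> free_module k" "state_kind m 0 < k"
    by (rule finite_rules_bound)
  show ?thesis
  proof (rule that [of "gen ` ?R" k "state_kind m 0"])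
    fix x assume x: "set_mset x \<subseteq> {..<m}"
    show "layer 0 (add_mset (0, state_kind m 0) (put 0 x)) \<in> semimod_gen (gen ` ?R)
      \<longleftrightarrow> (count x, \<lambda>_. 0) \<in> sem p"
      using machine_iff [OF M x] nstep_iff_mstep [OF ib x] implements_iff [OF E] es by auto
  qed (use k \<open>finite ?R\<close> in auto)
qed

section \<open>Rewriting of coded terms\<close>

fun conv :: "prog \<Rightarrow> prog" where
  "conv (Atom b c) = Atom (\<not> b) c"
| "conv (Seq p q) = Seq (conv q) (conv p)"
| "conv (Alt p q) = Alt (conv p) (conv q)"
| "conv (Star p) = Star (conv p)"

lemma sem_conv: "sem (conv p) = (sem p)\<inverse>"
  by (induction p) (auto simp: csem_def converse_relcomp rtrancl_converse)

lemma below_conv [simp]: "below m (conv p) = below m p"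
  by (induction p) auto

text \<open>The successor separates pairs from 0 and makes \<open>pr\<close> the Cons of
  \<open>list_encode\<close>, with 0 as the empty list.\<close>

definition pr :: "nat \<Rightarrow> nat \<Rightarrow> nat" where
  "pr a b = Suc (prod_encode (a, b))"

lemma pr_simps [simp]: "pr a b = pr c d \<longleftrightarrow> a = c \<and> b = d" "pr a b \<noteq> 0" "0 \<noteq> pr a b"
  by (simp_all add: pr_def)

text \<open>By Cantor's formula, \<open>pr a b\<close> is \<open>a + 1 + triangle (a + b)\<close>.
  The register \<open>Suc d\<close> first receives \<open>a + b\<close>, and the loop then adds
  \<open>a + b\<close>, \<open>a + b - 1\<close>, down to 1 to register \<open>d\<close>.\<close>

definition pair_prog :: "nat \<Rightarrow> prog" where
  "pair_prog d = Seq (Atom False (Add d (Suc d))) (Seq (Atom False (Inc d))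
     (Seq (Star (Seq (Atom False (Add (Suc d) d)) (Atom True (Inc (Suc d)))))
       (Atom False (IsZero (Suc d)))))"

text \<open>A pass is possible only while the counter is positive, since the decrement is blocked at
  zero. Requiring zero at the end therefore fixes the number of passes.\<close>

lemma triangle_loop:
  fixes d :: nat
  defines "B \<equiv> sem (Seq (Atom False (Add (Suc d) d)) (Atom True (Inc (Suc d))))"
  shows "(s, s') \<in> B\<^sup>* \<and> s' (Suc d) = 0 \<longleftrightarrow> s' = s(d := s d + triangle (s (Suc d)), Suc d := 0)"
proof -
  have B: "(s, s') \<in> B \<longleftrightarrow> (\<exists>c. s (Suc d) = Suc c \<and> s' = s(d := s d + Suc c, Suc d := c))" for s s'
  proof
    assume "(s, s') \<in> B"
    then have eq: "s(d := s d + s (Suc d)) = s'(Suc d := Suc (s' (Suc d)))"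
      by (auto simp: B_def csem_def)
    have "s (Suc d) = Suc (s' (Suc d))" using fun_cong [OF eq, of "Suc d"] by simp
    moreover have "s' i = (s(d := s d + s (Suc d), Suc d := s' (Suc d))) i" for i
      using fun_cong [OF eq, of i] by (auto split: if_splits)
    then have "s' = s(d := s d + s (Suc d), Suc d := s' (Suc d))" by (rule ext)
    ultimately show "\<exists>c. s (Suc d) = Suc c \<and> s' = s(d := s d + Suc c, Suc d := c)" by metis
  next
    assume "\<exists>c. s (Suc d) = Suc c \<and> s' = s(d := s d + Suc c, Suc d := c)"
    then obtain c where "s (Suc d) = Suc c" "s' = s(d := s d + Suc c, Suc d := c)" by blast
    then have "s(d := s d + s (Suc d)) = s'(Suc d := Suc (s' (Suc d)))" by (simp add: fun_eq_iff)
    then show "(s, s') \<in> B" by (simp add: B_def csem_def relcomp_unfold)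
  qed
  have "(s, s') \<in> B\<^sup>* \<Longrightarrow> s' (Suc d) = 0 \<Longrightarrow> s' = s(d := s d + triangle (s (Suc d)), Suc d := 0)"
    by (induction rule: converse_rtrancl_induct) (auto simp: B fun_eq_iff)
  moreover have "(s, s(d := s d + triangle c, Suc d := 0)) \<in> B\<^sup>*" if "s (Suc d) = c" for c s
    using that
  proof (induction c arbitrary: s)
    case 0
    then have "s(d := s d + triangle 0, Suc d := 0) = s" by (simp add: fun_eq_iff)
    then show ?case by simp
  next
    case (Suc c)
    let ?t = "s(d := s d + Suc c, Suc d := c)"
    have "(s, ?t) \<in> B" using Suc.prems by (simp add: B)
    also have "(?t, ?t(d := ?t d + triangle c, Suc d := 0)) \<in> B\<^sup>*" by (rule Suc.IH) simp
    also have "?t(d := ?t d + triangle c, Suc d := 0) = s(d := s d + triangle (Suc c), Suc d := 0)"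
      by (simp add: fun_eq_iff)
    finally show ?case .
  qed
  ultimately show ?thesis by auto
qed

lemma sem_pair_prog:
  "(s, s') \<in> sem (pair_prog d) \<longleftrightarrow> s' = s(d := pr (s d) (s (Suc d)), Suc d := 0)"
proof -
  let ?t = "(s(Suc d := s (Suc d) + s d))(d := Suc (s d))"
  let ?B = "sem (Seq (Atom False (Add (Suc d) d)) (Atom True (Inc (Suc d))))"
  have "(s, s') \<in> sem (pair_prog d) \<longleftrightarrow> (?t, s') \<in> ?B\<^sup>* \<and> s' (Suc d) = 0"
    by (auto simp: pair_prog_def csem_def relcomp_unfold)
  also have "\<dots> \<longleftrightarrow> s' = ?t(d := ?t d + triangle (?t (Suc d)), Suc d := 0)"
    by (rule triangle_loop)
  also have "?t(d := ?t d + triangle (?t (Suc d)), Suc d := 0) = s(d := pr (s d) (s (Suc d)), Suc d := 0)"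
    by (simp add: fun_eq_iff pr_def prod_encode_def add.commute)
  finally show ?thesis .
qed

section \<open>Building and matching terms in registers\<close>

datatype tm = TVar nat | TZero | TSuc tm | TPair tm tm

fun val :: "(nat \<Rightarrow> nat) \<Rightarrow> tm \<Rightarrow> nat" where
  "val s (TVar i) = s i"
| "val s TZero = 0"
| "val s (TSuc t) = Suc (val s t)"
| "val s (TPair t u) = pr (val s t) (val s u)"

fun vars :: "tm \<Rightarrow> nat set" where
  "vars (TVar i) = {i}"
| "vars TZero = {}"
| "vars (TSuc t) = vars t"
| "vars (TPair t u) = vars t \<union> vars u"

lemma val_cong: "(\<And>i. i \<in> vars t \<Longrightarrow> s i = s' i) \<Longrightarrow> val s t = val s' t"
  by (induction t) auto

text \<open>Registers below \<open>d\<close> hold the variables, those from \<open>d\<close> on form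
  an evaluation stack. The zero tests become final conditions in the backward reading, where they
  force the whole content of register \<open>d\<close> to be accounted for by the term.\<close>

fun build :: "tm \<Rightarrow> nat \<Rightarrow> prog" where
  "build (TVar i) d = Seq (Atom False (IsZero d)) (Atom False (Add i d))"
| "build TZero d = Atom False (IsZero d)"
| "build (TSuc t) d = Seq (build t d) (Atom False (Inc d))"
| "build (TPair t u) d = Seq (build t d) (Seq (build u (Suc d)) (pair_prog d))"

fun scratch :: "tm \<Rightarrow> nat" where
  "scratch (TVar i) = 0"
| "scratch TZero = 0"
| "scratch (TSuc t) = scratch t"
| "scratch (TPair t u) = max (scratch t) (Suc (scratch u))"

lemma below_build: "vars t \<subseteq> {..<d} \<Longrightarrow> d + scratch t < m \<Longrightarrow> below m (build t d)"
proof (induction t arbitrary: d)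
  case (TPair t u)
  have "below m (build t d)" using TPair by auto
  moreover have "below m (build u (Suc d))" using TPair by (intro TPair.IH(2)) auto
  ultimately show ?case using TPair.prems by (auto simp: pair_prog_def)
qed auto

lemma sem_build:
  "vars t \<subseteq> {..<d} \<Longrightarrow> (s, s') \<in> sem (build t d) \<longleftrightarrow>
    (\<forall>i. d \<le> i \<and> i \<le> d + scratch t \<longrightarrow> s i = 0) \<and> s' = s(d := val s t)"
proof (induction t arbitrary: d s s')
  case (TVar i)
  then show ?case by (auto simp: csem_def relcomp_unfold dest: le_antisym)
next
  case TZero
  then show ?case by (auto simp: csem_def dest: le_antisym)
next
  case (TSuc t)
  then have "(s, s') \<in> sem (build (TSuc t) d) \<longleftrightarrow>
      (\<exists>r. ((\<forall>i. d \<le> i \<and> i \<le> d + scratch t \<longrightarrow> s i = 0) \<and> r = s(d := val s t)) \<and> s' = r(d := Suc (r d)))"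
    by (auto simp: csem_def relcomp_unfold)
  then show ?case by auto
next
  case (TPair t u)
  have t: "vars t \<subseteq> {..<d}" and u: "vars u \<subseteq> {..<Suc d}" using TPair.prems by auto
  have val: "val (s(d := k)) u = val s u" for k
    using TPair.prems by (intro val_cong) auto
  let ?r = "s(d := val s t)"
  let ?q = "?r(Suc d := val ?r u)"
  have "(s, s') \<in> sem (build (TPair t u) d) \<longleftrightarrow>
      (\<exists>r q. (s, r) \<in> sem (build t d) \<and> (r, q) \<in> sem (build u (Suc d)) \<and> (q, s') \<in> sem (pair_prog d))"
    unfolding build.simps sem.simps by blast
  also have "\<dots> \<longleftrightarrow> (\<forall>i. d \<le> i \<and> i \<le> d + scratch t \<longrightarrow> s i = 0) \<and>
      (\<forall>i. Suc d \<le> i \<and> i \<le> Suc d + scratch u \<longrightarrow> ?r i = 0) \<and>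
      s' = ?q(d := pr (?q d) (?q (Suc d)), Suc d := 0)"
  proof -
    \<comment> \<open>Apart from their zero conditions the parts are functional, so the intermediate
      valuations can be eliminated.\<close>
    have one_point: "(\<exists>r q. (A \<and> r = r0) \<and> (C r \<and> q = f r) \<and> s' = g q) \<longleftrightarrow>
        A \<and> C r0 \<and> s' = g (f r0)" for A r0 C f g
      by blast
    show ?thesis
      unfolding TPair.IH(1) [OF t] TPair.IH(2) [OF u] sem_pair_prog by (rule one_point)
  qed
  also have "?q(d := pr (?q d) (?q (Suc d)), Suc d := 0) = s(d := pr (val s t) (val s u), Suc d := 0)"
    by (simp add: fun_eq_iff val)
  also have "(\<forall>i. Suc d \<le> i \<and> i \<le> Suc d + scratch u \<longrightarrow> ?r i = 0) \<longleftrightarrow>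
      (\<forall>i. Suc d \<le> i \<and> i \<le> Suc d + scratch u \<longrightarrow> s i = 0)"
    by auto
  finally have "(s, s') \<in> sem (build (TPair t u) d) \<longleftrightarrow>
      (\<forall>i. d \<le> i \<and> i \<le> d + scratch t \<longrightarrow> s i = 0) \<and>
      (\<forall>i. Suc d \<le> i \<and> i \<le> Suc d + scratch u \<longrightarrow> s i = 0) \<and>
      s' = s(d := pr (val s t) (val s u), Suc d := 0)" .
  also have "\<dots> \<longleftrightarrow> (\<forall>i. d \<le> i \<and> i \<le> d + scratch (TPair t u) \<longrightarrow> s i = 0) \<and>
      s' = s(d := pr (val s t) (val s u), Suc d := 0)"
  proof -
    have "(d \<le> i \<and> i \<le> d + scratch t) \<or> (Suc d \<le> i \<and> i \<le> Suc d + scratch u) \<longleftrightarrow>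
        d \<le> i \<and> i \<le> d + scratch (TPair t u)" for i by auto
    then show ?thesis by blast
  qed
  also have "\<dots> \<longleftrightarrow> (\<forall>i. d \<le> i \<and> i \<le> d + scratch (TPair t u) \<longrightarrow> s i = 0) \<and>
      s' = s(d := val s (TPair t u))"
  proof -
    \<comment> \<open>Clearing \<open>Suc d\<close> has no effect, as this register lies in the
      scratch area required to be zero.\<close>
    have "s(d := k, Suc d := 0) = s(d := k)"
      if "\<forall>i. d \<le> i \<and> i \<le> d + scratch (TPair t u) \<longrightarrow> s i = 0" for k
      using that by (auto simp: fun_eq_iff)
    then show ?thesis by auto
  qed
  finally show ?case .
qed

text \<open>Matching a pattern is building it backwards from guessed values of its variables.\<close>

definition clause :: "nat \<Rightarrow> tm \<times> tm \<Rightarrow> prog" where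
  "clause n c = Seq (Atom False (Guess n)) (Seq (conv (build (fst c) n))
     (Seq (build (snd c) n) (Atom True (Guess n))))"

definition reg :: "nat \<Rightarrow> nat \<Rightarrow> nat \<Rightarrow> nat" where
  "reg n x = (\<lambda>_. 0)(n := x)"

lemma reg_inject [simp]: "reg n x = reg n y \<longleftrightarrow> x = y"
  by (auto simp: reg_def dest: fun_upd_eqD)

text \<open>The left-hand side and the right-hand side are built from the same valuation
  \<open>r\<close>, which is guessed at the start and erased at the end.\<close>

lemma sem_clause:
  assumes "vars (fst c) \<subseteq> {..<n}" "vars (snd c) \<subseteq> {..<n}"
  shows "(reg n x, s') \<in> sem (clause n c) \<longleftrightarrow> (\<exists>r. x = val r (fst c) \<and> s' = reg n (val r (snd c)))"
proof
  assume "(reg n x, s') \<in> sem (clause n c)"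
  then obtain s1 r s3 where s1: "\<forall>i\<ge>n. s1 i = reg n x i"
    and r: "(r, s1) \<in> sem (build (fst c) n)" "(r, s3) \<in> sem (build (snd c) n)"
    and s': "\<forall>i<n. s' i = 0" "\<forall>i\<ge>n. s3 i = s' i"
    by (auto simp: clause_def csem_def sem_conv)
  then have s1r: "s1 = r(n := val r (fst c))" and s3r: "s3 = r(n := val r (snd c))"
    using assms by (simp_all add: sem_build)
  have "x = val r (fst c)" using s1 s1r by (auto simp: reg_def)
  moreover have "s' = reg n (val r (snd c))"
  proof
    fix i
    consider "i < n" | "i = n" | "n < i" by linarith
    then show "s' i = reg n (val r (snd c)) i"
    proof cases
      case 1
      then show ?thesis using s'(1) by (simp add: reg_def)
    next
      case 2
      then have "s' i = s3 i" using s'(2) by simp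
      with 2 show ?thesis by (simp add: s3r reg_def)
    next
      case 3
      then have "s' i = s3 i" "s1 i = reg n x i" using s'(2) s1 by simp_all
      with 3 show ?thesis by (simp add: s1r s3r reg_def)
    qed
  qed
  ultimately show "\<exists>r. x = val r (fst c) \<and> s' = reg n (val r (snd c))" by blast
next
  assume "\<exists>r. x = val r (fst c) \<and> s' = reg n (val r (snd c))"
  then obtain r where x: "x = val r (fst c)" and s': "s' = reg n (val r (snd c))" by blast
  \<comment> \<open>The valuation is cut off at \<open>n\<close> because building needs zeros in its
    scratch registers.\<close>
  let ?r = "\<lambda>i. if i < n then r i else 0"
  have val: "val ?r (fst c) = x" "val ?r (snd c) = val r (snd c)"
    unfolding x using assms by (auto intro!: val_cong)
  have "(reg n x, ?r(n := x)) \<in> sem (Atom False (Guess n))"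
    by (auto simp: csem_def reg_def)
  moreover have "(?r(n := x), ?r) \<in> sem (conv (build (fst c) n))"
    using assms(1) by (auto simp: sem_conv sem_build val)
  moreover have "(?r, ?r(n := val r (snd c))) \<in> sem (build (snd c) n)"
    using assms(2) by (auto simp: sem_build val)
  moreover have "(?r(n := val r (snd c)), s') \<in> sem (Atom True (Guess n))"
    by (auto simp: csem_def reg_def s')
  ultimately show "(reg n x, s') \<in> sem (clause n c)"
    unfolding clause_def sem.simps by blast
qed

lemma below_clause:
  assumes "vars (fst c) \<subseteq> {..<n}" "vars (snd c) \<subseteq> {..<n}"
    and "n + scratch (fst c) < m" "n + scratch (snd c) < m"
  shows "below m (clause n c)"
  using assms by (auto simp: clause_def intro: below_build)

text \<open>This is rewriting at the root only: a rule has to match the entire number.\<close>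

definition rewrite :: "(tm \<times> tm) list \<Rightarrow> (nat \<times> nat) set" where
  "rewrite cs = {(val r (fst c), val r (snd c)) | r c. c \<in> set cs}"

text \<open>The empty choice does nothing instead of failing, which is harmless under \<^const>\<open>Star\<close>.\<close>

fun choices :: "prog list \<Rightarrow> prog" where
  "choices [] = Atom False (Guess 0)"
| "choices (p # ps) = Alt p (choices ps)"

lemma sem_choices: "sem (choices ps) = Id \<union> (\<Union>p\<in>set ps. sem p)"
  by (induction ps) auto

lemma below_choices: "(\<And>p. p \<in> set ps \<Longrightarrow> below m p) \<Longrightarrow> below m (choices ps)"
  by (induction ps) auto

lemma sem_clauses:
  assumes "\<And>c. c \<in> set cs \<Longrightarrow> vars (fst c) \<subseteq> {..<n} \<and> vars (snd c) \<subseteq> {..<n}"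
  shows "(reg n x, reg n y) \<in> sem (Star (choices (map (clause n) cs))) \<longleftrightarrow> (x, y) \<in> (rewrite cs)\<^sup>*"
proof -
  let ?P = "\<Union>c\<in>set cs. sem (clause n c)"
  have "sem (choices (map (clause n) cs)) = Id \<union> ?P" by (simp add: sem_choices)
  then have star: "sem (Star (choices (map (clause n) cs))) = ?P\<^sup>*"
    by (simp only: sem.simps) (metis Un_commute rtrancl_reflcl)
  have one: "(reg n x, s) \<in> ?P \<longleftrightarrow> (\<exists>y. s = reg n y \<and> (x, y) \<in> rewrite cs)" for x s
  proof -
    have "(reg n x, s) \<in> ?P \<longleftrightarrow> (\<exists>c\<in>set cs. \<exists>r. x = val r (fst c) \<and> s = reg n (val r (snd c)))"
      using sem_clause assms by simp
    then show ?thesis unfolding rewrite_def by blast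
  qed
  have "(reg n x, s) \<in> ?P\<^sup>* \<Longrightarrow> \<exists>y. s = reg n y \<and> (x, y) \<in> (rewrite cs)\<^sup>*" for s
  proof (induction rule: rtrancl_induct)
    case (step s s')
    then show ?case using one by (metis rtrancl.rtrancl_into_rtrancl)
  qed auto
  moreover have "(x, y) \<in> (rewrite cs)\<^sup>* \<Longrightarrow> (reg n x, reg n y) \<in> ?P\<^sup>*"
  proof (induction rule: rtrancl_induct)
    case (step y z)
    then have "(reg n y, reg n z) \<in> ?P" using one by blast
    with step(3) show ?case by (rule rtrancl_into_rtrancl)
  qed simp
  ultimately show ?thesis unfolding star by (metis reg_inject)
qed

text \<open>The extra clause with left-hand side \<open>TVar 0\<close> matches every input and is
  applied exactly once, to form the start term. The target 0 means that no token is left in any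
  register.\<close>

theorem rewrite_semimodule:
  assumes vars: "\<And>c. c \<in> set ((TVar 0, t) # cs) \<Longrightarrow> vars (fst c) \<subseteq> {..<n} \<and> vars (snd c) \<subseteq> {..<n}"
  obtains k B h where "finite B" "B \<subseteq> free_module k" "n < k" "h < k" "n \<noteq> h"
    "\<And>x. layer 0 (add_mset (0, h) (replicate_mset x (0, n))) \<in> semimod_gen B \<longleftrightarrow>
      (\<exists>r. r 0 = x \<and> (val r t, 0) \<in> (rewrite cs)\<^sup>*)"
proof -
  let ?cs = "(TVar 0, t) # cs"
  \<comment> \<open>These are the highest registers touched when building the sides of the clauses;
    \<open>m\<close> lies above all of them.\<close>
  let ?K = "(\<lambda>c. n + scratch (fst c)) ` set ?cs \<union> (\<lambda>c. n + scratch (snd c)) ` set ?cs"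
  define m where "m = Suc (Max ?K)"
  have m: "k < m" if "k \<in> ?K" for k
    unfolding m_def using Max_ge [OF _ that] by (simp only: less_Suc_eq_le) simp
  have n: "n < m" using m [of "n + scratch (TVar 0)"] by simp
  let ?p = "Seq (clause n (TVar 0, t)) (Star (choices (map (clause n) cs)))"
  have "below m (clause n c)" if "c \<in> set ?cs" for c
    using vars [OF that] m that by (intro below_clause) auto
  then have "below m ?p" by (auto intro!: below_choices)
  then obtain B k h where B: "finite B" "B \<subseteq> free_module k" "m \<le> h" "h < k" and
    iff: "\<And>x. set_mset x \<subseteq> {..<m} \<Longrightarrow>
      layer 0 (add_mset (0, h) (put 0 x)) \<in> semimod_gen B \<longleftrightarrow> (count x, \<lambda>_. 0) \<in> sem ?p"
    by (rule program_semimodule) (rule that)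
  show ?thesis
  proof (rule that)
    fix x
    have "count (replicate_mset x n) = reg n x" "reg n 0 = (\<lambda>_. 0)" by (auto simp: reg_def fun_eq_iff)
    moreover have "put 0 (replicate_mset x n) = replicate_mset x (0, n)" by (simp add: put_def)
    ultimately have "layer 0 (add_mset (0, h) (replicate_mset x (0, n))) \<in> semimod_gen B \<longleftrightarrow>
        (reg n x, reg n 0) \<in> sem ?p"
      using iff [of "replicate_mset x n"] n by (auto split: if_splits)
    also have "\<dots> \<longleftrightarrow> (\<exists>r. r 0 = x \<and> (reg n (val r t), reg n 0) \<in> sem (Star (choices (map (clause n) cs))))"
      using sem_clause [of "(TVar 0, t)" n x] vars [of "(TVar 0, t)"]
      by (simp only: sem.simps relcomp_unfold) auto
    also have "\<dots> \<longleftrightarrow> (\<exists>r. r 0 = x \<and> (val r t, 0) \<in> (rewrite cs)\<^sup>*)"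
      using sem_clauses [of cs n] vars by simp
    finally show "layer 0 (add_mset (0, h) (replicate_mset x (0, n))) \<in> semimod_gen B \<longleftrightarrow>
      (\<exists>r. r 0 = x \<and> (val r t, 0) \<in> (rewrite cs)\<^sup>*)" .
  qed (use B n in auto)
qed

section \<open>An interpreter for recursive functions\<close>

declare list_encode.simps(2) [simp del]

lemma list_encode_Cons [simp]: "list_encode (x # xs) = pr x (list_encode xs)"
  by (simp add: list_encode.simps(2) pr_def)

lemma list_encode_eq_0 [simp]: "list_encode xs = 0 \<longleftrightarrow> xs = []" "0 = list_encode xs \<longleftrightarrow> xs = []"
  by (cases xs; simp)+

lemma list_encode_eq_pr:
  "list_encode xs = pr a b \<longleftrightarrow> (\<exists>ys. xs = a # ys \<and> b = list_encode ys)"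
  by (cases xs) auto

fun code :: "recf \<Rightarrow> nat" where
  "code Zero = pr 0 0"
| "code Succ = pr 1 0"
| "code (Proj i) = pr 2 i"
| "code (Comp f gs) = pr 3 (pr (code f) (list_encode (map code gs)))"
| "code (Prim f g) = pr 4 (pr (code f) (code g))"
| "code (Mn f) = pr 5 (code f)"

lemma code_eq_pr:
  "code f = pr 0 a \<longleftrightarrow> f = Zero \<and> a = 0"
  "code f = pr (Suc 0) a \<longleftrightarrow> f = Succ \<and> a = 0"
  "code f = pr 2 a \<longleftrightarrow> f = Proj a"
  "code f = pr 3 a \<longleftrightarrow> (\<exists>g gs. f = Comp g gs \<and> a = pr (code g) (list_encode (map code gs)))"
  "code f = pr 4 a \<longleftrightarrow> (\<exists>g h. f = Prim g h \<and> a = pr (code g) (code h))"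
  "code f = pr 5 a \<longleftrightarrow> (\<exists>g. f = Mn g \<and> a = code g)"
  by (cases f; auto)+

text \<open>Besides evaluation, two kinds of goals spread the bounded quantifiers in the premises of
  \<open>eval_Comp\<close> and \<open>eval_Mn\<close> over single steps.\<close>

datatype goal = Eval recf "nat list" nat | EvalAll "recf list" "nat list" "nat list"
  | Below recf nat "nat list"

fun holds :: "goal \<Rightarrow> bool" where
  "holds (Eval f xs y) \<longleftrightarrow> eval f xs y"
| "holds (EvalAll gs xs ys) \<longleftrightarrow> list_all2 (\<lambda>g. eval g xs) gs ys"
| "holds (Below f n xs) \<longleftrightarrow> (\<forall>m<n. \<exists>y. eval f (m # xs) (Suc y))"

fun gcode :: "goal \<Rightarrow> nat" where
  "gcode (Eval f xs y) = pr 0 (pr (code f) (pr (list_encode xs) y))"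
| "gcode (EvalAll gs xs ys) = pr 1 (pr (list_encode (map code gs)) (pr (list_encode xs) (list_encode ys)))"
| "gcode (Below f n xs) = pr 2 (pr (code f) (pr n (list_encode xs)))"

abbreviation stack :: "goal list \<Rightarrow> nat" where
  "stack gl \<equiv> list_encode (map gcode gl)"

fun tnum :: "nat \<Rightarrow> tm" where
  "tnum 0 = TZero"
| "tnum (Suc n) = TSuc (tnum n)"

lemma val_tnum [simp]: "val s (tnum n) = n"
  by (induction n) auto

lemma vars_tnum [simp]: "vars (tnum n) = {}"
  by (induction n) auto

text \<open>The last argument stands for the rest of the stack, so this and the next two terms are
  patterns for whole stacks.\<close>

definition tEval :: "tm \<Rightarrow> tm \<Rightarrow> tm \<Rightarrow> tm \<Rightarrow> tm" where
  "tEval f xs y r = TPair (TPair (tnum 0) (TPair f (TPair xs y))) r"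

definition tAll :: "tm \<Rightarrow> tm \<Rightarrow> tm \<Rightarrow> tm \<Rightarrow> tm" where
  "tAll gs xs ys r = TPair (TPair (tnum 1) (TPair gs (TPair xs ys))) r"

definition tBelow :: "tm \<Rightarrow> tm \<Rightarrow> tm \<Rightarrow> tm \<Rightarrow> tm" where
  "tBelow f n xs r = TPair (TPair (tnum 2) (TPair f (TPair n xs))) r"

lemma val_goals [simp]:
  "val s (tEval f xs y r) = pr (pr 0 (pr (val s f) (pr (val s xs) (val s y)))) (val s r)"
  "val s (tAll f xs y r) = pr (pr 1 (pr (val s f) (pr (val s xs) (val s y)))) (val s r)"
  "val s (tBelow f xs y r) = pr (pr 2 (pr (val s f) (pr (val s xs) (val s y)))) (val s r)"
  by (simp_all only: tEval_def tAll_def tBelow_def val.simps val_tnum)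

lemma vars_goals [simp]:
  "vars (tEval f xs y r) = vars f \<union> vars xs \<union> vars y \<union> vars r"
  "vars (tAll f xs y r) = vars f \<union> vars xs \<union> vars y \<union> vars r"
  "vars (tBelow f xs y r) = vars f \<union> vars xs \<union> vars y \<union> vars r"
  by (auto simp only: tEval_def tAll_def tBelow_def vars.simps vars_tnum)

text \<open>A variable that only occurs on the right-hand side of a rule is guessed.\<close>

definition interpreter :: "(tm \<times> tm) list" where
  "interpreter = (let r = TVar 0; f = TVar 1; g = TVar 2; x = TVar 3; xs = TVar 4; y = TVar 5; z = TVar 6
   in [(tEval (TPair (tnum 0) TZero) xs TZero r, r),
     (tEval (TPair (tnum 1) TZero) (TPair x xs) (TSuc x) r, r),
     (tEval (TPair (tnum 2) TZero) (TPair x xs) x r, r),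
     (tEval (TPair (tnum 2) (TSuc z)) (TPair x xs) y r, tEval (TPair (tnum 2) z) xs y r),
     (tEval (TPair (tnum 3) (TPair f g)) xs y r, tAll g xs z (tEval f z y r)),
     (tAll TZero xs TZero r, r),
     (tAll (TPair f g) xs (TPair y z) r, tEval f xs y (tAll g xs z r)),
     (tEval (TPair (tnum 4) (TPair f g)) (TPair TZero xs) y r, tEval f xs y r),
     (tEval (TPair (tnum 4) (TPair f g)) (TPair (TSuc x) xs) y r,
       tEval (TPair (tnum 4) (TPair f g)) (TPair x xs) z (tEval g (TPair x (TPair z xs)) y r)),
     (tEval (TPair (tnum 5) f) xs x r, tEval f (TPair x xs) TZero (tBelow f x xs r)),
     (tBelow f TZero xs r, r),
     (tBelow f (TSuc x) xs r, tEval f (TPair x xs) (TSuc y) (tBelow f x xs r))])"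

definition red :: "(nat \<times> nat) set" where
  "red = rewrite interpreter"

abbreviation reduces :: "nat \<Rightarrow> nat \<Rightarrow> bool" (infix \<open>\<rightarrow>\<close> 50) where
  "a \<rightarrow> b \<equiv> (a, b) \<in> red"

abbreviation reduces_rtrancl :: "nat \<Rightarrow> nat \<Rightarrow> bool" (infix \<open>\<rightarrow>*\<close> 50) where
  "a \<rightarrow>* b \<equiv> (a, b) \<in> red\<^sup>*"

text \<open>The interpreter on uncoded stacks, with one clause per rule and in the same order. The
  guessed values are \<open>ys\<close> in composition, \<open>z\<close> in primitive recursion and
  \<open>y\<close> in the last clause.\<close>

inductive gstep :: "goal list \<Rightarrow> goal list \<Rightarrow> bool" where
  "gstep (Eval Zero xs 0 # r) r"
| "gstep (Eval Succ (x # xs) (Suc x) # r) r"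
| "gstep (Eval (Proj 0) (x # xs) x # r) r"
| "gstep (Eval (Proj (Suc i)) (x # xs) y # r) (Eval (Proj i) xs y # r)"
| "gstep (Eval (Comp f gs) xs y # r) (EvalAll gs xs ys # Eval f ys y # r)"
| "gstep (EvalAll [] xs [] # r) r"
| "gstep (EvalAll (g # gs) xs (y # ys) # r) (Eval g xs y # EvalAll gs xs ys # r)"
| "gstep (Eval (Prim f g) (0 # xs) y # r) (Eval f xs y # r)"
| "gstep (Eval (Prim f g) (Suc n # xs) y # r) (Eval (Prim f g) (n # xs) z # Eval g (n # z # xs) y # r)"
| "gstep (Eval (Mn f) xs n # r) (Eval f (n # xs) 0 # Below f n xs # r)"
| "gstep (Below f 0 xs # r) r"
| "gstep (Below f (Suc n) xs # r) (Eval f (n # xs) (Suc y) # Below f n xs # r)"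

text \<open>A valuation given as a list in the order \<open>r\<close>, \<open>f\<close>,
  \<open>g\<close>, \<open>x\<close>, \<open>xs\<close>, \<open>y\<close>, \<open>z\<close> of the
  variables of \<open>interpreter\<close>, padded with zeros.\<close>

definition env :: "nat list \<Rightarrow> nat \<Rightarrow> nat" where
  "env xs i = (if i < length xs then xs ! i else 0)"

section \<open>Coded reductions compared with steps on goal stacks\<close>

lemma interpreter_rule:
  assumes "k < 12"
  shows "val s (fst (interpreter ! k)) \<rightarrow> val s (snd (interpreter ! k))"
proof -
  have "length interpreter = 12" by (simp add: interpreter_def Let_def)
  then have "interpreter ! k \<in> set interpreter" using assms by (metis nth_mem)
  then show ?thesis unfolding red_def rewrite_def by blast
qed

lemma gstep_imp_reduces: "gstep gl gl' \<Longrightarrow> stack gl \<rightarrow> stack gl'"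
proof (induction rule: gstep.induct)
  case (1 xs r)
  show ?case using interpreter_rule [ of 0 "env [stack r, 0, 0, 0, list_encode xs]"]
    by (simp add: interpreter_def env_def Let_def)
next
  case (2 x xs r)
  show ?case using interpreter_rule [ of 1 "env [stack r, 0, 0, x, list_encode xs]"]
    by (simp add: interpreter_def env_def Let_def)
next
  case (3 x xs r)
  show ?case using interpreter_rule [ of 2 "env [stack r, 0, 0, x, list_encode xs]"]
    by (simp add: interpreter_def env_def Let_def)
next
  case (4 i x xs y r)
  show ?case using interpreter_rule [ of 3 "env [stack r, 0, 0, x, list_encode xs, y, i]"]
    by (simp add: interpreter_def env_def Let_def)
next
  case (5 f gs xs y r ys)
  show ?case using interpreter_rule [
      of 4 "env [stack r, code f, list_encode (map code gs), 0, list_encode xs, y, list_encode ys]"]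
    by (simp add: interpreter_def env_def Let_def)
next
  case (6 xs r)
  show ?case using interpreter_rule [ of 5 "env [stack r, 0, 0, 0, list_encode xs]"]
    by (simp add: interpreter_def env_def Let_def)
next
  case (7 g gs xs y ys r)
  show ?case using interpreter_rule [
      of 6 "env [stack r, code g, list_encode (map code gs), 0, list_encode xs, y, list_encode ys]"]
    by (simp add: interpreter_def env_def Let_def)
next
  case (8 f g xs y r)
  show ?case using interpreter_rule [
      of 7 "env [stack r, code f, code g, 0, list_encode xs, y]"]
    by (simp add: interpreter_def env_def Let_def)
next
  case (9 f g n xs y r z)
  show ?case using interpreter_rule [
      of 8 "env [stack r, code f, code g, n, list_encode xs, y, z]"]
    by (simp add: interpreter_def env_def Let_def)
next
  case (10 f xs n r)
  show ?case using interpreter_rule [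
      of 9 "env [stack r, code f, 0, n, list_encode xs]"]
    by (simp add: interpreter_def env_def Let_def)
next
  case (11 f xs r)
  show ?case using interpreter_rule [
      of 10 "env [stack r, code f, 0, 0, list_encode xs]"]
    by (simp add: interpreter_def env_def Let_def)
next
  case (12 f n xs r y)
  show ?case using interpreter_rule [
      of 11 "env [stack r, code f, 0, n, list_encode xs, y]"]
    by (simp add: interpreter_def env_def Let_def)
qed

lemma stack_eq_pr: "stack gl = pr a b \<longleftrightarrow> (\<exists>g r. gl = g # r \<and> a = gcode g \<and> b = stack r)"
  by (cases gl) auto

lemma gcode_eq_pr:
  "gcode g = pr 0 a \<longleftrightarrow> (\<exists>f xs y. g = Eval f xs y \<and> a = pr (code f) (pr (list_encode xs) y))"
  "gcode g = pr (Suc 0) a \<longleftrightarrow> (\<exists>gs xs ys. g = EvalAll gs xs ys \<and>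
     a = pr (list_encode (map code gs)) (pr (list_encode xs) (list_encode ys)))"
  "gcode g = pr 2 a \<longleftrightarrow> (\<exists>f n xs. g = Below f n xs \<and> a = pr (code f) (pr n (list_encode xs)))"
  by (cases g; auto)+

lemma codes_eq_pr:
  "list_encode (map code fs) = pr a b \<longleftrightarrow>
    (\<exists>g gs. fs = g # gs \<and> a = code g \<and> b = list_encode (map code gs))"
  by (cases fs) auto

lemma ex_list_encode: "\<exists>xs. n = list_encode xs"
  by (metis list_decode_inverse)

lemmas shape = stack_eq_pr gcode_eq_pr code_eq_pr codes_eq_pr list_encode_eq_pr

lemmas shape_sym = shape [THEN trans [OF eq_commute]]

text \<open>Tags and pairs can be decoded uniquely, so the rule that applies determines the shape of
  the stack. Guessing cannot leave the set of stack codes: a guessed number is either a plain value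
  or, in composition, the code of some list.\<close>

lemma reduces_imp_gstep:
  assumes "stack gl \<rightarrow> b"
  obtains gl' where "gstep gl gl'" "b = stack gl'"
proof -
  from assms obtain s c where c: "c \<in> set interpreter" "stack gl = val s (fst c)" "b = val s (snd c)"
    unfolding red_def rewrite_def by blast
  \<comment> \<open>Variable 6 is the one guessed as the list of intermediate values in composition;
    \<open>list_encode\<close> is onto.\<close>
  obtain zs where zs: "list_encode zs = s 6" using ex_list_encode [of "s 6"] by metis
  from c(1) show ?thesis
    unfolding interpreter_def Let_def list.set
    by (elim insertE emptyE; insert c(2,3); clarsimp simp: shape shape_sym)
      (rule that, erule ssubst [of gl],
        rule gstep.intros(1-4) gstep.intros(5) [of _ _ _ _ _ zs] gstep.intros(6-),
        (simp add: zs; fail))+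
qed

text \<open>Each step replaces the first goal by premises that suffice to derive it, so truth passes
  backwards from the empty stack.\<close>

lemma gstep_holds: "gstep gl gl' \<Longrightarrow> \<forall>g\<in>set gl'. holds g \<Longrightarrow> \<forall>g\<in>set gl. holds g"
proof (induction rule: gstep.induct)
  case (4 i x xs y r)
  then show ?case by (auto elim!: eval.cases [of "Proj i"] intro: eval_Proj [of "Suc i" "x # xs", simplified])
next
  case (5 f gs xs y r ys)
  then show ?case by (auto simp: list_all2_conv_all_nth intro!: eval_Comp [of ys gs])
next
  case (10 f xs n r)
  then show ?case by (auto intro!: eval_Mn)
next
  case (12 f n xs r y)
  then show ?case by (auto simp: less_Suc_eq)
qed (auto intro: eval.intros eval_Proj [of 0 "x # xs" for x xs, simplified])

lemma stack_sound: "stack gl \<rightarrow>* 0 \<Longrightarrow> \<forall>g\<in>set gl. holds g"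
proof (induction "stack gl" arbitrary: gl rule: converse_rtrancl_induct)
  case base
  then show ?case by simp
next
  case (step b)
  from step(1) obtain gl' where "gstep gl gl'" "b = stack gl'" by (rule reduces_imp_gstep)
  with step(3) gstep_holds show ?case by blast
qed

text \<open>The premise has the form of the induction hypothesis of \<open>eval_complete\<close>: a
  goal can be solved on top of any remaining stack.\<close>

lemma all_complete:
  assumes "list_all2 (\<lambda>g y. \<forall>r. gstep\<^sup>*\<^sup>* (Eval g xs y # r) r) gs ys"
  shows "gstep\<^sup>*\<^sup>* (EvalAll gs xs ys # r) r"
  using assms
proof (induction rule: list_all2_induct)
  case Nil
  show ?case by (blast intro: gstep.intros)
next
  case (Cons g gs y ys)
  have "gstep (EvalAll (g # gs) xs (y # ys) # r) (Eval g xs y # EvalAll gs xs ys # r)" by (rule gstep.intros)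
  also have "gstep\<^sup>*\<^sup>* (Eval g xs y # EvalAll gs xs ys # r) (EvalAll gs xs ys # r)" using Cons by blast
  also have "gstep\<^sup>*\<^sup>* (EvalAll gs xs ys # r) r" by (rule Cons.IH)
  finally show ?case .
qed

lemma below_complete:
  assumes "\<forall>m<n. \<exists>y. \<forall>r. gstep\<^sup>*\<^sup>* (Eval f (m # xs) (Suc y) # r) r"
  shows "gstep\<^sup>*\<^sup>* (Below f n xs # r) r"
  using assms
proof (induction n)
  case 0
  show ?case by (blast intro: gstep.intros)
next
  case (Suc n)
  then obtain y where y: "\<forall>r. gstep\<^sup>*\<^sup>* (Eval f (n # xs) (Suc y) # r) r" by blast
  have "gstep (Below f (Suc n) xs # r) (Eval f (n # xs) (Suc y) # Below f n xs # r)" by (rule gstep.intros)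
  also have "gstep\<^sup>*\<^sup>* (Eval f (n # xs) (Suc y) # Below f n xs # r) (Below f n xs # r)" using y by blast
  also have "gstep\<^sup>*\<^sup>* (Below f n xs # r) r" using Suc by simp
  finally show ?case .
qed

lemma proj_complete: "i < length xs \<Longrightarrow> gstep\<^sup>*\<^sup>* (Eval (Proj i) xs (xs ! i) # r) r"
proof (induction i arbitrary: xs)
  case 0
  then show ?case by (cases xs) (auto intro: gstep.intros)
next
  case (Suc i)
  then obtain x zs where xs: "xs = x # zs" by (cases xs) auto
  have "gstep (Eval (Proj (Suc i)) (x # zs) (zs ! i) # r) (Eval (Proj i) zs (zs ! i) # r)"
    by (rule gstep.intros)
  also have "gstep\<^sup>*\<^sup>* (Eval (Proj i) zs (zs ! i) # r) r" using Suc xs by simp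
  finally show ?case by (simp add: xs)
qed

lemma eval_complete: "eval f xs y \<Longrightarrow> gstep\<^sup>*\<^sup>* (Eval f xs y # r) r"
proof (induction arbitrary: r rule: eval.induct)
  case (eval_Proj i xs)
  then show ?case by (rule proj_complete)
next
  case (eval_Comp ys gs xs f z)
  have "gstep (Eval (Comp f gs) xs z # r) (EvalAll gs xs ys # Eval f ys z # r)" by (rule gstep.intros)
  also have "gstep\<^sup>*\<^sup>* (EvalAll gs xs ys # Eval f ys z # r) (Eval f ys z # r)"
    using eval_Comp by (intro all_complete) (auto simp: list_all2_conv_all_nth)
  also have "gstep\<^sup>*\<^sup>* (Eval f ys z # r) r" using eval_Comp by blast
  finally show ?case .
next
  case (eval_Prim0 f xs y g)
  have "gstep (Eval (Prim f g) (0 # xs) y # r) (Eval f xs y # r)" by (rule gstep.intros)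
  also have "gstep\<^sup>*\<^sup>* (Eval f xs y # r) r" using eval_Prim0 by blast
  finally show ?case .
next
  case (eval_PrimS f g n xs y z)
  have "gstep (Eval (Prim f g) (Suc n # xs) z # r) (Eval (Prim f g) (n # xs) y # Eval g (n # y # xs) z # r)"
    by (rule gstep.intros)
  also have "gstep\<^sup>*\<^sup>* (Eval (Prim f g) (n # xs) y # Eval g (n # y # xs) z # r) (Eval g (n # y # xs) z # r)"
    using eval_PrimS by blast
  also have "gstep\<^sup>*\<^sup>* (Eval g (n # y # xs) z # r) r" using eval_PrimS by blast
  finally show ?case .
next
  case (eval_Mn f n xs)
  have "gstep (Eval (Mn f) xs n # r) (Eval f (n # xs) 0 # Below f n xs # r)" by (rule gstep.intros)
  also have "gstep\<^sup>*\<^sup>* (Eval f (n # xs) 0 # Below f n xs # r) (Below f n xs # r)"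
    using eval_Mn by blast
  \<comment> \<open>\<open>Below\<close> asks for values of the form \<open>Suc y\<close>, which the
    nonzero values in \<open>eval_Mn\<close> are.\<close>
  also have "gstep\<^sup>*\<^sup>* (Below f n xs # r) r"
    using eval_Mn by (intro below_complete) (metis not0_implies_Suc)
  finally show ?case .
qed (blast intro: gstep.intros)+

lemma gsteps_imp_reduces: "gstep\<^sup>*\<^sup>* gl gl' \<Longrightarrow> stack gl \<rightarrow>* stack gl'"
  by (induction rule: rtranclp_induct) (auto intro: rtrancl_into_rtrancl gstep_imp_reduces)

theorem interpreter_iff: "stack [Eval f xs y] \<rightarrow>* 0 \<longleftrightarrow> eval f xs y"
proof
  assume "stack [Eval f xs y] \<rightarrow>* 0"
  from stack_sound [OF this] show "eval f xs y" by simp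
next
  assume "eval f xs y"
  from gsteps_imp_reduces [OF eval_complete [OF this, of "[]"]]
  show "stack [Eval f xs y] \<rightarrow>* 0" by simp
qed

section \<open>Diagonalisation\<close>

text \<open>Determinism is what makes the diagonal contradictory: the value 1 excludes a derivation
  of 0. For minimisation, neither of two results can be smaller, since it would be a zero where a
  nonzero value is required.\<close>

lemma eval_det: "eval f xs y \<Longrightarrow> eval f xs y' \<Longrightarrow> y = y'"
proof (induction arbitrary: y' rule: eval.induct)
  case (eval_Comp ys gs xs f z)
  from eval_Comp.prems obtain ys' where ys': "length ys' = length gs"
    "\<forall>i<length gs. eval (gs ! i) xs (ys' ! i)" "eval f ys' y'"
    by (cases rule: eval.cases) auto
  have "ys = ys'"
    using eval_Comp.hyps(1) eval_Comp.IH(1) ys' by (intro nth_equalityI) auto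
  with ys' eval_Comp.IH(2) show ?case by blast
next
  case (eval_Prim0 f xs y g)
  from eval_Prim0.prems show ?case
    by (cases rule: eval.cases) (auto intro: eval_Prim0.IH)
next
  case (eval_PrimS f g n xs y z)
  from eval_PrimS.prems obtain w where "eval (Prim f g) (n # xs) w" "eval g (n # w # xs) y'"
    by (cases rule: eval.cases) auto
  with eval_PrimS.IH show ?case by blast
next
  case (eval_Mn f n xs)
  from eval_Mn.prems have y': "eval f (y' # xs) 0" "\<forall>m<y'. \<exists>z. eval f (m # xs) z \<and> z \<noteq> 0"
    by (cases rule: eval.cases; auto)+
  then have "\<not> n < y'" using eval_Mn.IH(1) by blast
  moreover have "\<not> y' < n" using eval_Mn.IH(2) y'(1) by blast
  ultimately show ?case by simp
qed (auto elim: eval.cases)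

section \<open>Recursive functions that form the inputs\<close>

lemma eval_Comp1: "eval g xs a \<Longrightarrow> eval f [a] z \<Longrightarrow> eval (Comp f [g]) xs z"
  by (rule eval_Comp [of "[a]"]) auto

lemma eval_Comp2: "eval g xs a \<Longrightarrow> eval h xs b \<Longrightarrow> eval f [a, b] z \<Longrightarrow> eval (Comp f [g, h]) xs z"
  by (rule eval_Comp [of "[a, b]"]) (auto simp: less_Suc_eq)

lemma eval_Proj0: "eval (Proj 0) (x # xs) x"
  using eval_Proj [of 0 "x # xs"] by simp

lemma eval_Proj1: "eval (Proj 1) (x # y # xs) y"
  using eval_Proj [of 1 "x # y # xs"] by simp

text \<open>The step function of \<open>Prim\<close> receives the predecessor first and the previous
  value second, hence \<open>Proj 1\<close>.\<close>

definition radd :: recf where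
  "radd = Prim (Proj 0) (Comp Succ [Proj 1])"

lemma eval_radd: "eval radd [m, n] (m + n)"
proof (induction m)
  case 0
  show ?case by (auto simp: radd_def intro: eval_Prim0 eval_Proj0)
next
  case (Suc m)
  have "eval (Comp Succ [Proj 1]) [m, m + n, n] (Suc (m + n))"
    by (rule eval_Comp1 [OF eval_Proj1 eval_Succ])
  with Suc show ?case unfolding radd_def by (auto intro: eval_PrimS)
qed

definition rtriangle :: recf where
  "rtriangle = Prim Zero (Comp Succ [Comp radd [Proj 1, Proj 0]])"

lemma eval_rtriangle: "eval rtriangle [n] (triangle n)"
proof (induction n)
  case 0
  show ?case by (auto simp: rtriangle_def intro: eval_Prim0 eval_Zero)
next
  case (Suc n)
  have "eval (Comp Succ [Comp radd [Proj 1, Proj 0]]) [n, triangle n] (Suc (triangle n + n))"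
    by (rule eval_Comp1 [OF eval_Comp2 [OF eval_Proj1 eval_Proj0 eval_radd] eval_Succ])
  with Suc have "eval rtriangle [Suc n] (Suc (triangle n + n))"
    unfolding rtriangle_def by (rule eval_PrimS)
  then show ?case by simp
qed

definition recursive :: "(nat \<Rightarrow> nat) \<Rightarrow> bool" where
  "recursive \<phi> \<longleftrightarrow> (\<exists>f. \<forall>x. eval f [x] (\<phi> x))"

lemma recursive_id: "recursive (\<lambda>x. x)"
  unfolding recursive_def by (blast intro: eval_Proj0)

lemma recursive_Suc: "recursive \<phi> \<Longrightarrow> recursive (\<lambda>x. Suc (\<phi> x))"
  unfolding recursive_def by (blast intro: eval_Comp1 eval_Succ)

lemma recursive_const: "recursive (\<lambda>_. n)"
proof (induction n)
  case 0
  show ?case unfolding recursive_def by (blast intro: eval_Zero)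
qed (rule recursive_Suc)

lemma recursive_add: "recursive \<phi> \<Longrightarrow> recursive \<psi> \<Longrightarrow> recursive (\<lambda>x. \<phi> x + \<psi> x)"
  unfolding recursive_def by (blast intro: eval_Comp2 eval_radd)

lemma recursive_prod_encode:
  assumes "recursive \<phi>" "recursive \<psi>"
  shows "recursive (\<lambda>x. prod_encode (\<phi> x, \<psi> x))"
proof -
  have "recursive (\<lambda>x. \<phi> x + \<psi> x)" using assms by (rule recursive_add)
  then have "recursive (\<lambda>x. triangle (\<phi> x + \<psi> x))"
    unfolding recursive_def by (blast intro: eval_Comp1 eval_rtriangle)
  then show ?thesis using recursive_add [OF _ assms(1)] by (simp add: prod_encode_def)
qed

text \<open>The \<open>x\<close> tokens of kind \<open>n\<close> enter as a single coefficient, so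
  the list has two entries whatever \<open>x\<close> is.\<close>

definition input :: "nat \<Rightarrow> nat \<Rightarrow> nat \<Rightarrow> entry list" where
  "input h n x = [((0, 0), h, 1), ((0, 0), n, int x)]"

lemma denote_input: "h \<noteq> n \<Longrightarrow> denote (input h n x) = layer 0 (add_mset (0, h) (replicate_mset x (0, n)))"
  by (auto simp: denote_def input_def layer_def fun_eq_iff)

lemma recursive_encode_input: "recursive (\<lambda>x. encode_input (input h n x))"
proof -
  \<comment> \<open>Nonnegative integers have even codes; writing \<open>x + x\<close> reduces the
    doubling to addition.\<close>
  have "int_encode (int x) = x + x" for x by (simp add: int_encode_def sum_encode_def)
  then have "encode_input (input h n x) = Suc (prod_encode (encode_entry ((0, 0), h, 1),
      Suc (prod_encode (prod_encode (prod_encode (int_encode 0, int_encode 0), prod_encode (n, x + x)), 0))))" for x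
    by (simp add: encode_input_def input_def encode_entry_def pr_def)
  moreover have "recursive (\<lambda>x. Suc (prod_encode (encode_entry ((0, 0), h, 1),
      Suc (prod_encode (prod_encode (prod_encode (int_encode 0, int_encode 0), prod_encode (n, x + x)), 0)))))"
    by (intro recursive_Suc recursive_prod_encode recursive_const recursive_add recursive_id)
  ultimately show ?thesis by simp
qed

text \<open>\<open>membership_problem\<close> speaks of some list with the given code; injectivity
  identifies it with the intended one.\<close>

lemma encode_input_inject: "encode_input l = encode_input l' \<longleftrightarrow> l = l'"
proof -
  have "inj encode_entry"
    by (rule injI) (auto simp: encode_entry_def prod_encode_eq int_encode_eq split: prod.splits)
  then show ?thesis by (simp add: encode_input_def list_encode_eq inj_map_eq_map)
qed

theorem theorem1:
  shows "\<exists>k B. finite B \<and> B \<subseteq> free_module k \<and>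
           \<not> decidable_nat_set (membership_problem k (semimod_gen B))"
proof -
  \<comment> \<open>With \<open>x\<close> for variable 0 this codes the stack whose only goal is
    that the function with code \<open>x\<close>, applied to \<open>x\<close>, has value 0.\<close>
  let ?t = "tEval (TVar 0) (TPair (TVar 0) TZero) TZero TZero"
  \<comment> \<open>The interpreter uses the variables 0 to 6, so register 7 holds the term.\<close>
  have vars: "vars (fst c) \<subseteq> {..<7} \<and> vars (snd c) \<subseteq> {..<7}"
    if "c \<in> set ((TVar 0, ?t) # interpreter)" for c
    using that by (auto simp: interpreter_def Let_def)
  obtain k B h where B: "finite B" "B \<subseteq> free_module k" "7 < k" "h < k" "7 \<noteq> h" and
    iff: "\<And>x. layer 0 (add_mset (0, h) (replicate_mset x (0, 7))) \<in> semimod_gen B \<longleftrightarrow>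
      (\<exists>r. r 0 = x \<and> (val r ?t, 0) \<in> (rewrite interpreter)\<^sup>*)"
    by (rule rewrite_semimodule [OF vars]) (assumption, rule that)
  have "\<not> decidable_nat_set (membership_problem k (semimod_gen B))"
  proof
    let ?A = "membership_problem k (semimod_gen B)"
    assume "decidable_nat_set ?A"
    then obtain f where f: "\<And>n. eval f [n] (if n \<in> ?A then 1 else 0)"
      unfolding decidable_nat_set_def by blast
    obtain g where g: "\<And>x. eval g [x] (encode_input (input h 7 x))"
      using recursive_encode_input unfolding recursive_def by blast
    \<comment> \<open>On the code of any function, \<open>d\<close> returns 1 or 0 according to
      whether that function yields 0 on its own code.\<close>
    define d where "d = Comp f [g]"
    define a where "a = encode_input (input h 7 (code d))"
    have d: "eval d [code d] (if a \<in> ?A then 1 else 0)"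
      unfolding d_def a_def by (rule eval_Comp1 [OF g f])
    have "a \<in> ?A \<longleftrightarrow> denote (input h 7 (code d)) \<in> semimod_gen B"
      using B by (auto simp: membership_problem_def a_def encode_input_inject valid_input_def input_def)
    also have "\<dots> \<longleftrightarrow> (\<exists>r. r 0 = code d \<and> val r ?t \<rightarrow>* 0)"
      using B iff by (simp add: denote_input red_def)
    \<comment> \<open>Variable 0 is the only one in the start term, so the choice of
      \<open>r\<close> elsewhere is irrelevant.\<close>
    also have "\<dots> \<longleftrightarrow> stack [Eval d [code d] 0] \<rightarrow>* 0"
      by (auto intro: exI [of _ "\<lambda>_. code d"])
    also have "\<dots> \<longleftrightarrow> eval d [code d] 0" by (rule interpreter_iff)
    \<comment> \<open>If \<open>a\<close> is in the set, \<open>d\<close> has both values 1 and 0 on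
      its own code; otherwise its value 0 puts \<open>a\<close> into the set.\<close>
    finally show False using d eval_det by fastforce
  qed
  with B show ?thesis by blast
qed

end
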